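(* Let $L>0$ and let $u:\mathbb R\to\mathbb C$, $x\mapsto u(x)$, be such that, after defining $u(s)\equiv u(L\cot(s))$, we have that the function $\sin(s)u_{ss}(s)+2\cos(s)u_s(s)$ belongs to $\mathcal C^2[0,\pi]$. Let $\alpha\in(0,1)\cup(1,2)$ and let $N\in\mathbb N$. For $r\in\mathbb N$, let $h_r=\pi/(2rN)$, $\tilde s_n=h_r n$, $\tilde s_{n+1/2}=h_r(n+1/2)$, and let $s_j=\frac{(2j+1)\pi}{2N}$ for $j\in\{0,\ldots,N-1\}$. Let $(-\Delta)^{\alpha/2}u(s_j)$ denote the fractional Laplacian of $u$ at $x=x_j=L\cot(s_j)$, given by $$(-\Delta)^{\alpha/2}u(s_j)=\frac{c_\alpha|\sin(s_j)|^{\alpha-1}}{L^\alpha\alpha(1-\alpha)}\int_0^\pi\frac{\sin^\alpha(\eta)\,(\sin(\eta)u_{ss}(\eta)+2\cos(\eta)u_s(\eta))}{|\sin(s_j-\eta)|^{\alpha-1}}\,d\eta .$$ Define $$A_{1,j}=\frac1{h_r}\frac{c_\alpha|\sin(s_j)|^{\alpha-1}}{L^\alpha\alpha(1-\alpha)}\sum_{n=0}^{rN-1}\left(\frac{\sin(\tilde s_{n+1/2})}{\tilde s_{n+1/2}}\right)^\alpha\left(\frac{\sin(\tilde s_{n+1/2}-s_j)}{\tilde s_{n+1/2}-s_j}\right)^{1-\alpha}\frac{\tilde s_{n+1}^{\alpha+1}-\tilde s_n^{\alpha+1}}{\alpha+1}$$ $$\qquad\cdot\frac{\operatorname{sgn}(\tilde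 s_{n+1}-s_j)|\tilde s_{n+1}-s_j|^{2-\alpha}-\operatorname{sgn}(\tilde s_n-s_j)|\tilde s_n-s_j|^{2-\alpha}}{2-\alpha}\,\bigl(\sin(\tilde s_{n+1/2})u_{ss}(\tilde s_{n+1/2})+2\cos(\tilde s_{n+1/2})u_s(\tilde s_{n+1/2})\bigr),$$ $$A_{2,j}=\frac1{h_r}\frac{c_\alpha|\sin(s_j)|^{\alpha-1}}{L^\alpha\alpha(1-\alpha)}\sum_{n=rN}^{2rN-1}\left(\frac{\sin(\tilde s_{n+1/2})}{\pi-\tilde s_{n+1/2}}\right)^\alpha\left(\frac{\sin(\tilde s_{n+1/2}-s_j)}{\tilde s_{n+1/2}-s_j}\right)^{1-\alpha}\frac{(\pi-\tilde s_n)^{\alpha+1}-(\pi-\tilde s_{n+1})^{\alpha+1}}{\alpha+1}$$ $$\qquad\cdot\frac{\operatorname{sgn}(\tilde s_{n+1}-s_j)|\tilde s_{n+1}-s_j|^{2-\alpha}-\operatorname{sgn}(\tilde s_n-s_j)|\tilde s_n-s_j|^{2-\alpha}}{2-\alpha}\,\bigl(\sin(\tilde s_{n+1/2})u_{ss}(\tilde s_{n+1/2})+2\cos(\tilde s_{n+1/2})u_s(\tilde s_{n+1/2})\bigr).$$ Then there exists a constant $K>0$, independent of $r$ and $j$, such that, for all $r\in\mathbb N$ and all $j\in\{0,\ldots,N-1\}$, the error $E_j=(-\Delta)^{\alpha/2}u(s_j)-A_{1,j}-A_{2,j}$ satisfies $|E_j|\le K/r^2$.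
   Context: $\mathbb N=\{1,2,3,\ldots\}$. The function $\operatorname{sgn}$ is the sign function, with $\operatorname{sgn}(0)=0$. The constant is $c_\alpha=\alpha\dfrac{2^{\alpha-1}\Gamma(1/2+\alpha/2)}{\sqrt{\pi}\,\Gamma(1-\alpha/2)}$. The subscripts in $u_s$ and $u_{ss}$ denote first and second derivatives with respect to $s\in[0,\pi]$ of $u(s)\equiv u(L\cot(s))$. The integral formula displayed in the claim is taken as the definition of $(-\Delta)^{\alpha/2}u(s_j)$. *)

theory Defs
  imports "HOL-Analysis.Analysis"
begin

(* One-sided derivatives at the endpoints; the library's C1_differentiable_on uses
   two-sided ones, which would constrain f outside [a, b]. *)
definition C2_on_interval :: "real \<Rightarrow> real \<Rightarrow> (real \<Rightarrow> complex) \<Rightarrow> bool" where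
  "C2_on_interval a b f \<longleftrightarrow>
    (\<exists>f' f''. (\<forall>x\<in>{a..b}. (f has_vector_derivative f' x) (at x within {a..b})) \<and>
             (\<forall>x\<in>{a..b}. (f' has_vector_derivative f'' x) (at x within {a..b})) \<and>
             continuous_on {a..b} f'')"

(* u_cot, u_s, u_ss and u_comb are meaningful for 0 < s < pi only; at the endpoints, where
   the cotangent has a pole, their values are arbitrary and are only ever used inside an
   integral. *)
definition u_cot :: "real \<Rightarrow> (real \<Rightarrow> complex) \<Rightarrow> real \<Rightarrow> complex" where
  "u_cot L u s = u (L * cot s)"

definition u_s :: "real \<Rightarrow> (real \<Rightarrow> complex) \<Rightarrow> real \<Rightarrow> complex" where
  "u_s L u s = vector_derivative (u_cot L u) (at s)"

definition u_ss :: "real \<Rightarrow> (real \<Rightarrow> complex) \<Rightarrow> real \<Rightarrow> complex" where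
  "u_ss L u s = vector_derivative (u_s L u) (at s)"

definition u_comb :: "real \<Rightarrow> (real \<Rightarrow> complex) \<Rightarrow> real \<Rightarrow> complex" where
  "u_comb L u s = sin s *\<^sub>R u_ss L u s + (2 * cos s) *\<^sub>R u_s L u s"

definition c_frac :: "real \<Rightarrow> real" where
  "c_frac \<alpha> = \<alpha> * (2 powr (\<alpha> - 1) * Gamma (1/2 + \<alpha>/2)) / (sqrt pi * Gamma (1 - \<alpha>/2))"

definition prefactor :: "real \<Rightarrow> real \<Rightarrow> real \<Rightarrow> real" where
  "prefactor L \<alpha> s = c_frac \<alpha> * \<bar>sin s\<bar> powr (\<alpha> - 1) / (L powr \<alpha> * \<alpha> * (1 - \<alpha>))"

(* The fractional Laplacian of order \<alpha>/2 of u, evaluated at x = L * cot s. *)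
definition frac_laplacian :: "real \<Rightarrow> real \<Rightarrow> (real \<Rightarrow> complex) \<Rightarrow> real \<Rightarrow> complex" where
  "frac_laplacian L \<alpha> u s = prefactor L \<alpha> s *\<^sub>R
     integral {0..pi} (\<lambda>\<eta>. (sin \<eta> powr \<alpha> / \<bar>sin (s - \<eta>)\<bar> powr (\<alpha> - 1)) *\<^sub>R u_comb L u \<eta>)"

definition step :: "nat \<Rightarrow> nat \<Rightarrow> real" where
  "step N r = pi / (2 * real r * real N)"

(* The index is real so that half-integers are allowed. *)
definition grid :: "nat \<Rightarrow> nat \<Rightarrow> real \<Rightarrow> real" where
  "grid N r t = step N r * t"

definition node :: "nat \<Rightarrow> nat \<Rightarrow> real" where
  "node N j = (2 * real j + 1) * pi / (2 * real N)"

definition signed_powr :: "real \<Rightarrow> real \<Rightarrow> real" where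
  "signed_powr x p = sgn x * \<bar>x\<bar> powr p"

definition A1 :: "real \<Rightarrow> real \<Rightarrow> (real \<Rightarrow> complex) \<Rightarrow> nat \<Rightarrow> nat \<Rightarrow> nat \<Rightarrow> complex" where
  "A1 L \<alpha> u N r j = (1 / step N r * prefactor L \<alpha> (node N j)) *\<^sub>R
     (\<Sum>n = 0..<r * N.
        let a = grid N r (real n); b = grid N r (real n + 1); m = grid N r (real n + 1/2);
            s = node N j
        in ((sin m / m) powr \<alpha> * (sin (m - s) / (m - s)) powr (1 - \<alpha>)
             * ((b powr (\<alpha> + 1) - a powr (\<alpha> + 1)) / (\<alpha> + 1))
             * ((signed_powr (b - s) (2 - \<alpha>) - signed_powr (a - s) (2 - \<alpha>)) / (2 - \<alpha>)))
           *\<^sub>R u_comb L u m)"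

definition A2 :: "real \<Rightarrow> real \<Rightarrow> (real \<Rightarrow> complex) \<Rightarrow> nat \<Rightarrow> nat \<Rightarrow> nat \<Rightarrow> complex" where
  "A2 L \<alpha> u N r j = (1 / step N r * prefactor L \<alpha> (node N j)) *\<^sub>R
     (\<Sum>n = r * N..<2 * r * N.
        let a = grid N r (real n); b = grid N r (real n + 1); m = grid N r (real n + 1/2);
            s = node N j
        in ((sin m / (pi - m)) powr \<alpha> * (sin (m - s) / (m - s)) powr (1 - \<alpha>)
             * (((pi - a) powr (\<alpha> + 1) - (pi - b) powr (\<alpha> + 1)) / (\<alpha> + 1))
             * ((signed_powr (b - s) (2 - \<alpha>) - signed_powr (a - s) (2 - \<alpha>)) / (2 - \<alpha>)))
           *\<^sub>R u_comb L u m)"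

end

theory Submission
  imports Defs "HOL-Complex_Analysis.Complex_Analysis"
begin

text \<open>
  Write $s = s_j$, $\psi(x) = |x-s|^{1-\alpha}$, $\varphi(x) = \min(x,\pi-x)^\alpha$. The integrand
  is $\psi\varphi g$ with $g$ twice continuously differentiable on each half of $[0,\pi]$, and the
  rule replaces $\int_I \psi\varphi g$ by $h^{-1}\int_I\varphi\,\int_I\psi\; g(m_I)$ on each cell $I$
  with midpoint $m_I$.

  On cells away from $s$ the functions $\psi$ and $g$ are smooth. Since $\varphi$ minus its mean
  integrates to zero, the error is at most $C h^2 (h + \mathrm{osc}_I\,\varphi)$, and the oscillations
  of $\varphi$ sum to its total variation.

  On cells close to $s$ the function $F = \varphi g$ is smooth, also across $\pi/2$, and the error is
  $F'(s) \int_I \psi(x)(x-m_I)\,dx$ up to $C h^2\int_I\psi$. For $\alpha > 1$ the first term alone is of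
  order $h^{3-\alpha}$, which is too large, but $s$ is a grid point, so these terms are antisymmetric
  under reflection in $s$ and cancel over a set of cells symmetric about $s$.

  All smoothness facts come from restricting holomorphic functions to the real line.
\<close>

section \<open>Twice differentiable functions on an interval\<close>

text \<open>The zone counted as close to s has a width fixed by N, not by h. Every node is at least
  pi/(2N) away from 0 and pi, so a window of half-width at most pi/(4N) keeps clear of the end
  points, where powers of x and pi - x need not be smooth, and outside a quarter of that distance
  the derivatives of |x - s|^(1 - \<alpha>) are bounded independently of h. The obstacle at pi/2 is
  real: both min(x, pi - x)^\<alpha> and g have a kink there, and pi/2 is itself a node whenever N =
  2j + 1. Only the product F can then provide one slope F'(s) for the cells on both sides. A common
  slope is indispensable, because antisymmetry cancels bare moments and not moments weighted with
  F'(m_I). Trading F'(m_I) for F'(s) is affordable since the moment of a cell is at most a constant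
  times h^2 times its mass divided by |m_I - s|, which exactly offsets the growth of |F'(m_I) -
  F'(s)|.\<close>

lemma C2_on_interval_cong:
  assumes "C2_on_interval a b f" "\<And>x. x \<in> {a..b} \<Longrightarrow> g x = f x"
  shows "C2_on_interval a b g"
proof -
  obtain f' f'' where d: "\<forall>x\<in>{a..b}. (f has_vector_derivative f' x) (at x within {a..b})"
    "\<forall>x\<in>{a..b}. (f' has_vector_derivative f'' x) (at x within {a..b})"
    "continuous_on {a..b} f''"
    using assms(1) unfolding C2_on_interval_def by blast
  have "\<forall>x\<in>{a..b}. (g has_vector_derivative f' x) (at x within {a..b})"
    using d(1) assms(2) has_vector_derivative_transform by (metis (no_types, lifting))
  with d show ?thesis unfolding C2_on_interval_def by blast
qed

lemma C2_on_interval_subset: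
  assumes "C2_on_interval a b f" "a \<le> c" "d \<le> b"
  shows "C2_on_interval c d f"
proof -
  obtain f' f'' where d: "\<forall>x\<in>{a..b}. (f has_vector_derivative f' x) (at x within {a..b})"
    "\<forall>x\<in>{a..b}. (f' has_vector_derivative f'' x) (at x within {a..b})"
    "continuous_on {a..b} f''"
    using assms(1) unfolding C2_on_interval_def by blast
  have s: "{c..d} \<subseteq> {a..b}" using assms by auto
  show ?thesis unfolding C2_on_interval_def
    by (rule exI[of _ f'], rule exI[of _ f''])
      (use d s in \<open>blast intro: has_vector_derivative_within_subset continuous_on_subset\<close>)
qed

lemma C2_on_interval_mult:
  assumes "C2_on_interval a b f" "C2_on_interval a b g"
  shows "C2_on_interval a b (\<lambda>x. f x * g x)"
proof -
  obtain f' f'' where f: "\<forall>x\<in>{a..b}. (f has_vector_derivative f' x) (at x within {a..b})"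
    "\<forall>x\<in>{a..b}. (f' has_vector_derivative f'' x) (at x within {a..b})"
    "continuous_on {a..b} f''"
    using assms(1) unfolding C2_on_interval_def by blast
  obtain g' g'' where g: "\<forall>x\<in>{a..b}. (g has_vector_derivative g' x) (at x within {a..b})"
    "\<forall>x\<in>{a..b}. (g' has_vector_derivative g'' x) (at x within {a..b})"
    "continuous_on {a..b} g''"
    using assms(2) unfolding C2_on_interval_def by blast
  have c: "continuous_on {a..b} f" "continuous_on {a..b} g" "continuous_on {a..b} f'" "continuous_on {a..b} g'"
    using f g by (auto intro: continuous_on_vector_derivative)
  show ?thesis unfolding C2_on_interval_def
  proof (intro exI conjI ballI)
    fix x assume x: "x \<in> {a..b}"
    show "((\<lambda>x. f x * g x) has_vector_derivative f x * g' x + f' x * g x) (at x within {a..b})"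
      using f g x by (intro has_vector_derivative_mult) auto
    show "((\<lambda>x. f x * g' x + f' x * g x) has_vector_derivative
        (f x * g'' x + f' x * g' x) + (f' x * g' x + f'' x * g x)) (at x within {a..b})"
      using f g x by (intro has_vector_derivative_add has_vector_derivative_mult) auto
  next
    show "continuous_on {a..b} (\<lambda>x. (f x * g'' x + f' x * g' x) + (f' x * g' x + f'' x * g x))"
      using f(3) g(3) c by (intro continuous_intros)
  qed
qed

text \<open>\<open>deriv f\<close> and \<open>deriv (deriv f)\<close> are again holomorphic, so no
  real second derivative of a power or a quotient ever has to be computed.\<close>

lemma C2_on_interval_holomorphic:
  assumes "open S" "f holomorphic_on S" "\<And>x. x \<in> {a..b} \<Longrightarrow> complex_of_real x \<in> S"
  shows "C2_on_interval a b (\<lambda>x. f (of_real x))"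
proof -
  have h1: "deriv f holomorphic_on S" and h2: "deriv (deriv f) holomorphic_on S"
    using assms by (auto intro: holomorphic_deriv)
  have d: "((\<lambda>x. g (complex_of_real x)) has_vector_derivative deriv g (of_real x)) (at x within {a..b})"
    if "g holomorphic_on S" "x \<in> {a..b}" for g x
  proof -
    have "(g has_field_derivative deriv g (of_real x)) (at (of_real x))"
      using that assms by (auto intro: holomorphic_derivI)
    then show ?thesis
      by (rule has_vector_derivative_real_field)
  qed
  show ?thesis unfolding C2_on_interval_def
  proof (intro exI conjI ballI)
    show "continuous_on {a..b} (\<lambda>x. deriv (deriv f) (complex_of_real x))"
      by (rule continuous_on_compose2[OF holomorphic_on_imp_continuous_on[OF h2]])
        (use assms in \<open>auto intro!: continuous_intros\<close>)
  qed (use d assms h1 in auto)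
qed

text \<open>The principal power is holomorphic off the nonpositive real axis. Composed with the
  entire function \<open>f\<close>, it is holomorphic on the preimage of the slit plane, an open set
  that contains the interval because \<open>\<phi>\<close> is positive there.\<close>

lemma C2_on_interval_powr:
  fixes \<phi> :: "real \<Rightarrow> real"
  assumes "f holomorphic_on UNIV" "\<And>x. x \<in> {a..b} \<Longrightarrow> f (of_real x) = of_real (\<phi> x)"
    and "\<And>x. x \<in> {a..b} \<Longrightarrow> \<phi> x > 0"
  shows "C2_on_interval a b (\<lambda>x. of_real (\<phi> x powr p))"
proof (rule C2_on_interval_cong)
  let ?S = "f -` (- \<real>\<^sub>\<le>\<^sub>0)"
  have o: "open ?S"
    using assms(1) by (intro open_vimage holomorphic_on_imp_continuous_on) (auto simp: open_Compl)
  show "C2_on_interval a b (\<lambda>x. (\<lambda>z. f z powr of_real p) (of_real x))"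
  proof (rule C2_on_interval_holomorphic[OF o])
    show "(\<lambda>z. f z powr of_real p) holomorphic_on ?S"
      using assms(1) by (intro holomorphic_intros) (auto intro: holomorphic_on_subset)
  qed (use assms in \<open>auto simp: nonpos_Reals_of_real_iff\<close>, smt)
  show "complex_of_real (\<phi> x powr p) = f (of_real x) powr of_real p" if "x \<in> {a..b}" for x
    using assms(2,3)[OF that] by (simp add: powr_of_real)
qed

text \<open>The error estimates use smoothness through these bounds, with one constant for all of
  them. \<open>f'\<close> is delivered along with \<open>B\<close> because first-order Taylor terms
  must be named before they can be cancelled.\<close>

lemma C2_on_interval_bounds:
  assumes "C2_on_interval a b f"
  obtains f' B where "B \<ge> 0" "\<And>x. x \<in> {a..b} \<Longrightarrow> norm (f x) \<le> B"
    "\<And>x y. x \<in> {a..b} \<Longrightarrow> y \<in> {a..b} \<Longrightarrow> norm (f x - f y) \<le> B * \<bar>x - y\<bar>"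
    "\<And>x y. x \<in> {a..b} \<Longrightarrow> y \<in> {a..b} \<Longrightarrow> norm (f' x - f' y) \<le> B * \<bar>x - y\<bar>"
    "\<And>x y. x \<in> {a..b} \<Longrightarrow> y \<in> {a..b} \<Longrightarrow> norm (f x - f y - (x - y) *\<^sub>R f' y) \<le> B * (x - y)\<^sup>2"
proof -
  obtain f' f'' where d: "\<And>x. x\<in>{a..b} \<Longrightarrow> (f has_vector_derivative f' x) (at x within {a..b})"
    "\<And>x. x\<in>{a..b} \<Longrightarrow> (f' has_vector_derivative f'' x) (at x within {a..b})"
    "continuous_on {a..b} f''"
    using assms unfolding C2_on_interval_def by blast
  have c: "continuous_on {a..b} f" "continuous_on {a..b} f'"
    using d by (blast intro: continuous_on_vector_derivative)+
  have bd: "\<exists>B. \<forall>x\<in>{a..b}. norm (k x) \<le> B" if "continuous_on {a..b} k" for k :: "real \<Rightarrow> complex"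
    using compact_imp_bounded[OF compact_continuous_image[OF that compact_Icc]]
    by (auto simp: bounded_iff)
  obtain B0 where B0: "\<forall>x\<in>{a..b}. norm (f x) \<le> B0" using bd[OF c(1)] by blast
  obtain B1 where B1: "\<forall>x\<in>{a..b}. norm (f' x) \<le> B1" using bd[OF c(2)] by blast
  obtain B2 where B2: "\<forall>x\<in>{a..b}. norm (f'' x) \<le> B2" using bd[OF d(3)] by blast
  define B where "B = max 0 (max B0 (max B1 B2))"
  have B: "B0 \<le> B" "B1 \<le> B" "B2 \<le> B" "0 \<le> B" by (auto simp: B_def)
  have lip: "norm (k x - k y) \<le> C * \<bar>x - y\<bar>"
    if k: "\<And>x. x \<in> {a..b} \<Longrightarrow> (k has_vector_derivative k' x) (at x within {a..b})"
      "\<And>x. x \<in> {a..b} \<Longrightarrow> norm (k' x) \<le> C" "x \<in> {a..b}" "y \<in> {a..b}"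
    for k k' :: "real \<Rightarrow> complex" and C x y
  proof -
    have "norm (k x - k y) \<le> C * norm (x - y)"
    proof (rule differentiable_bound[of "{a..b}" k "\<lambda>x h. h *\<^sub>R k' x"])
      fix z assume z: "z \<in> {a..b}"
      show "(k has_derivative (\<lambda>h. h *\<^sub>R k' z)) (at z within {a..b})"
        using k(1)[OF z] by (simp add: has_vector_derivative_def)
      show "onorm (\<lambda>h. h *\<^sub>R k' z) \<le> C"
        using k(2)[OF z] by (intro onorm_le) (simp add: mult.commute[of C] mult_left_mono)
    qed (use k in auto)
    then show ?thesis by simp
  qed
  have l0: "norm (f x - f y) \<le> B * \<bar>x - y\<bar>" if "x \<in> {a..b}" "y \<in> {a..b}" for x y
    by (rule lip[OF d(1)]) (use that B1 B in fastforce)+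
  have l1: "norm (f' x - f' y) \<le> B * \<bar>x - y\<bar>" if "x \<in> {a..b}" "y \<in> {a..b}" for x y
    by (rule lip[OF d(2)]) (use that B2 B in fastforce)+
  have "norm (f x - f y - (x - y) *\<^sub>R f' y) \<le> B * (x - y)\<^sup>2" if xy: "x \<in> {a..b}" "y \<in> {a..b}" for x y
  proof -
    \<comment> \<open>Along the segment the derivative stays within
      \<open>B * \<bar>x - y\<bar>\<close> of \<open>f' y\<close>; the mean value inequality
      supplies the second factor.\<close>
    have "norm (f x - f y - (x - y) *\<^sub>R f' y) \<le> norm (x - y) * (B * \<bar>x - y\<bar>)"
    proof (rule vector_differentiable_bound_linearization[where S = "closed_segment y x"])
      fix z assume z: "z \<in> closed_segment y x"
      have sub: "closed_segment y x \<subseteq> {a..b}"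
        using xy by (auto simp: closed_segment_eq_real_ivl split: if_splits)
      then have "z \<in> {a..b}" using z by blast
      then show "(f has_vector_derivative f' z) (at z within closed_segment y x)"
        using d(1) sub has_vector_derivative_within_subset by blast
      have "norm (f' z - f' y) \<le> B * \<bar>z - y\<bar>" using l1 \<open>z \<in> {a..b}\<close> xy by blast
      also have "\<dots> \<le> B * \<bar>x - y\<bar>"
        using z B(4) by (intro mult_left_mono) (auto simp: closed_segment_eq_real_ivl split: if_splits)
      finally show "norm (f' z - f' y) \<le> B * \<bar>x - y\<bar>" .
    qed auto
    then show ?thesis by (simp add: power2_eq_square algebra_simps)
  qed
  moreover have "norm (f x) \<le> B" if "x \<in> {a..b}" for x using B0 B that by fastforce
  ultimately show ?thesis using that B(4) l0 l1 by metis
qed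

lemma C2_on_interval_continuous:
  assumes "C2_on_interval a b f"
  shows "continuous_on {a..b} f"
  using assms unfolding C2_on_interval_def by (blast intro: continuous_on_vector_derivative)

section \<open>The removable singularity of sin x / x\<close>

definition sinc :: "real \<Rightarrow> real" where
  "sinc x = (if x = 0 then 1 else sin x / x)"

lemma sinc_minus [simp]: "sinc (- x) = sinc x"
  by (simp add: sinc_def)

lemma sinc_pos: "\<bar>x\<bar> < pi \<Longrightarrow> sinc x > 0"
  using sin_gt_zero[of x] sin_gt_zero[of "-x"]
  by (cases x "0::real" rule: linorder_cases) (auto simp: sinc_def divide_neg_neg)

text \<open>With the value 1 at 0, where plain division would give 0, the quotient extends to an
  entire function; the limit behind this is the derivative of sin at 0. The bound by pi keeps the
  base of the power positive. The affine argument covers x, pi - x and x - s at once.\<close>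

lemma C2_on_interval_sinc_powr:
  assumes "\<And>x. x \<in> {a..b} \<Longrightarrow> \<bar>c + e * x\<bar> < pi"
  shows "C2_on_interval a b (\<lambda>x. of_real (sinc (c + e * x) powr p))"
proof -
  let ?f = "\<lambda>z::complex. if z = 0 then 1 else sin z / z"
  have "(sin has_field_derivative 1) (at (0::complex))"
    using DERIV_sin[of "0::complex"] by simp
  then have lim: "(\<lambda>z::complex. sin z / z) \<midarrow>0\<rightarrow> 1"
    by (simp add: DERIV_def)
  have hol: "?f holomorphic_on UNIV"
    by (rule removable_singularity[OF _ _ lim]) (auto intro!: holomorphic_intros)
  have "(\<lambda>z. ?f (of_real c + of_real e * z)) holomorphic_on UNIV"
    using holomorphic_on_compose_gen[of "\<lambda>z. of_real c + of_real e * z" UNIV ?f UNIV] hol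
    by (simp add: o_def holomorphic_intros)
  moreover have "?f (of_real c + of_real e * of_real x) = of_real (sinc (c + e * x))" for x
  proof -
    have "complex_of_real c + of_real e * of_real x = of_real (c + e * x)" by simp
    then show ?thesis unfolding sinc_def by (simp only: of_real_eq_0_iff sin_of_real) simp
  qed
  ultimately show ?thesis
    using assms by (intro C2_on_interval_powr) (auto intro: sinc_pos)
qed

section \<open>The singular weight\<close>

text \<open>For \<alpha> > 1 the weight |x - s|^(1 - \<alpha>) is unbounded near s, and
  integrability cannot come from continuity. It comes from multiplying an absolutely integrable
  function by a bounded measurable one.\<close>

lemma integrable_nonneg_scaleR_continuous:
  fixes w :: "real \<Rightarrow> real" and F :: "real \<Rightarrow> complex"
  assumes "w integrable_on {a..b}" "\<And>x. w x \<ge> 0" "continuous_on {a..b} F"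
  shows "(\<lambda>x. w x *\<^sub>R F x) integrable_on {a..b}"
proof -
  have "w absolutely_integrable_on {a..b}"
    using assms by (intro nonnegative_absolutely_integrable_1) auto
  moreover have "bounded (F ` {a..b})"
    using assms by (intro compact_imp_bounded compact_continuous_image) auto
  moreover have "F \<in> borel_measurable (lebesgue_on {a..b})"
    using assms by (intro continuous_imp_measurable_on_sets_lebesgue) auto
  moreover have "bilinear (\<lambda>(c::complex) (x::real). x *\<^sub>R c)"
    by (auto simp: bilinear_def intro!: linearI simp: scaleR_add_left scaleR_add_right)
  ultimately have "(\<lambda>x. w x *\<^sub>R F x) absolutely_integrable_on {a..b}"
    using absolutely_integrable_bounded_measurable_product[of "\<lambda>c x. x *\<^sub>R c" F "{a..b}" w] by auto
  then show ?thesis by (rule set_lebesgue_integral_eq_integral(1))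
qed

lemma has_integral_norm_bound:
  fixes f :: "real \<Rightarrow> 'a::euclidean_space" and g :: "real \<Rightarrow> real"
  assumes "(f has_integral i) S" "(g has_integral j) S" "\<And>x. x \<in> S \<Longrightarrow> norm (f x) \<le> g x"
  shows "norm i \<le> j"
  using has_integral_norm_bound_integral_component[of f i S g j 1] assms by simp

text \<open>This is the gain from sampling at the midpoint: linear Taylor terms drop out.\<close>

lemma has_integral_centered:
  fixes a b :: real
  assumes "a \<le> b"
  shows "((\<lambda>x. x - (a + b) / 2) has_integral 0) {a..b}"
proof -
  define m where "m = (a + b) / 2"
  have "((\<lambda>x. x - m) has_integral ((b\<^sup>2 / 2 - m * b) - (a\<^sup>2 / 2 - m * a))) {a..b}"
    by (rule fundamental_theorem_of_calculus)
      (use assms in \<open>auto intro!: derivative_eq_intros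
        simp: has_real_derivative_iff_has_vector_derivative[symmetric]\<close>)
  moreover have "(b\<^sup>2 / 2 - m * b) - (a\<^sup>2 / 2 - m * a) = 0"
    by (simp add: m_def power2_eq_square field_simps)
  ultimately show ?thesis by (simp add: m_def)
qed

lemma signed_powr_has_real_derivative:
  assumes "x \<noteq> 0"
  shows "((\<lambda>x. signed_powr x (p + 1)) has_real_derivative (p + 1) * \<bar>x\<bar> powr p) (at x)"
proof (cases "x > 0")
  case True
  have "((\<lambda>x. x powr (p + 1)) has_real_derivative (p + 1) * \<bar>x\<bar> powr p) (at x)"
    using True by (auto intro!: derivative_eq_intros)
  then show ?thesis
    by (rule has_field_derivative_transform_within_open[where S = "{0<..}"])
      (use True in \<open>auto simp: signed_powr_def\<close>)
next
  case False
  have "((\<lambda>x. - ((- x) powr (p + 1))) has_real_derivative (p + 1) * \<bar>x\<bar> powr p) (at x)"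
    using False assms by (auto intro!: derivative_eq_intros)
  then show ?thesis
    by (rule has_field_derivative_transform_within_open[where S = "{..<0}"])
      (use False assms in \<open>auto simp: signed_powr_def\<close>)
qed

lemma signed_powr_mono:
  assumes "p > 0" "x \<le> y"
  shows "signed_powr x p \<le> signed_powr y p"
proof -
  consider "0 \<le> x" | "x < 0" "0 \<le> y" | "x < 0" "y < 0" by linarith
  then show ?thesis
  proof cases
    case 1
    then show ?thesis using assms powr_mono2[of p x y] by (auto simp: signed_powr_def sgn_if)
  next
    case 2
    have "signed_powr x p \<le> 0" "0 \<le> signed_powr y p" using 2 by (auto simp: signed_powr_def)
    then show ?thesis by linarith
  next
    case 3
    then show ?thesis using assms powr_mono2[of p "-y" "-x"] by (auto simp: signed_powr_def)
  qed
qed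

lemma continuous_on_signed_powr:
  assumes "p > 0"
  shows "continuous_on A (\<lambda>x. signed_powr x p)"
proof -
  \<comment> \<open>Powers of the positive and the negative part; one of them always vanishes, as
    \<open>0 powr p = 0\<close>.\<close>
  have "signed_powr x p = max 0 x powr p - max 0 (-x) powr p" for x
    by (auto simp: signed_powr_def max_def)
  then show ?thesis
    using assms by (auto intro!: continuous_intros continuous_on_powr')
qed

text \<open>The antiderivative remains continuous at \<open>s\<close> because p + 1 > 0, even if the
  integrand blows up there, so the fundamental theorem applies with \<open>s\<close> as exceptional
  point. The signed powers of the quadrature rule originate here.\<close>

lemma has_integral_abs_powr:
  fixes s :: real
  assumes "p > -1" "a \<le> b"
  shows "((\<lambda>x. \<bar>x - s\<bar> powr p) has_integral
    (signed_powr (b - s) (p + 1) - signed_powr (a - s) (p + 1)) / (p + 1)) {a..b}"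
proof -
  have "((\<lambda>x. \<bar>x - s\<bar> powr p) has_integral
    (signed_powr (b - s) (p + 1) / (p + 1) - signed_powr (a - s) (p + 1) / (p + 1))) {a..b}"
  proof (rule fundamental_theorem_of_calculus_interior_strong[where S = "{s}"])
    fix x assume "x \<in> {a<..<b} - {s}"
    then have "((\<lambda>x. signed_powr (x - s) (p + 1)) has_real_derivative
        (p + 1) * \<bar>x - s\<bar> powr p * 1) (at x)"
      by (intro DERIV_chain2[where f = "\<lambda>x. signed_powr x (p + 1)" and g = "\<lambda>x. x - s"]
          signed_powr_has_real_derivative derivative_eq_intros) auto
    from DERIV_cdivide[OF this, of "p + 1"]
    show "((\<lambda>x. signed_powr (x - s) (p + 1) / (p + 1)) has_vector_derivative
        \<bar>x - s\<bar> powr p) (at x)"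
      using assms by (simp add: has_real_derivative_iff_has_vector_derivative)
  next
    show "continuous_on {a..b} (\<lambda>x. signed_powr (x - s) (p + 1) / (p + 1))"
      using assms
      by (intro continuous_intros
          continuous_on_compose2[OF continuous_on_signed_powr[of "p + 1" UNIV]]) auto
  qed (use assms in auto)
  then show ?thesis by (simp add: diff_divide_distrib)
qed

lemma has_integral_abs_powr_moment:
  fixes s :: real
  assumes "p > -1" "a \<le> b"
  shows "((\<lambda>x. \<bar>x - s\<bar> powr p * (x - s)) has_integral
    (\<bar>b - s\<bar> powr (p + 2) - \<bar>a - s\<bar> powr (p + 2)) / (p + 2)) {a..b}"
proof -
  have "((\<lambda>x. \<bar>x - s\<bar> powr p * (x - s)) has_integral
    (\<bar>b - s\<bar> powr (p + 2) / (p + 2) - \<bar>a - s\<bar> powr (p + 2) / (p + 2))) {a..b}"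
  proof (rule fundamental_theorem_of_calculus_interior_strong[where S = "{s}"])
    fix x assume x: "x \<in> {a<..<b} - {s}"
    have d: "((\<lambda>x. \<bar>x\<bar> powr (p + 2)) has_real_derivative (p + 2) * (\<bar>y\<bar> powr p * y)) (at y)"
      if "y \<noteq> 0" for y :: real
    proof (cases "y > 0")
      case True
      have e: "y powr (p + 1) = y powr p * y" using True by (simp add: powr_add)
      have "((\<lambda>x. x powr (p + 2)) has_real_derivative (p + 2) * (\<bar>y\<bar> powr p * y)) (at y)"
        using True e by (auto intro!: derivative_eq_intros simp: algebra_simps)
      then show ?thesis
        by (rule has_field_derivative_transform_within_open[where S = "{0<..}"])
          (use True in auto)
    next
      case False
      have e: "(- y) powr (p + 1) = - (\<bar>y\<bar> powr p * y)" using False that by (simp add: powr_add)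
      have "((\<lambda>x. (- x) powr (p + 2)) has_real_derivative (p + 2) * (\<bar>y\<bar> powr p * y)) (at y)"
        using False that e by (auto intro!: derivative_eq_intros simp: algebra_simps)
      then show ?thesis
        by (rule has_field_derivative_transform_within_open[where S = "{..<0}"])
          (use False that in auto)
    qed
    have "((\<lambda>x. \<bar>x - s\<bar> powr (p + 2)) has_real_derivative
        (p + 2) * (\<bar>x - s\<bar> powr p * (x - s)) * 1) (at x)"
      using x
      by (intro DERIV_chain2[where f = "\<lambda>x. \<bar>x\<bar> powr (p + 2)" and g = "\<lambda>x. x - s"]
          d derivative_eq_intros) auto
    from DERIV_cdivide[OF this, of "p + 2"]
    show "((\<lambda>x. \<bar>x - s\<bar> powr (p + 2) / (p + 2)) has_vector_derivative
        \<bar>x - s\<bar> powr p * (x - s)) (at x)"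
      using assms by (simp add: has_real_derivative_iff_has_vector_derivative)
  next
    show "continuous_on {a..b} (\<lambda>x. \<bar>x - s\<bar> powr (p + 2) / (p + 2))"
      using assms by (auto intro!: continuous_intros continuous_on_powr')
  qed (use assms in auto)
  then show ?thesis by (simp add: diff_divide_distrib)
qed

definition pow_mass :: "real \<Rightarrow> real \<Rightarrow> real \<Rightarrow> real \<Rightarrow> real" where
  "pow_mass s p a b = integral {a..b} (\<lambda>x. \<bar>x - s\<bar> powr p)"

text \<open>The moment is taken about the midpoint of the cell and not about \<open>s\<close>: it is
  the coefficient of the slope in the error made by sampling a smooth factor at the midpoint while
  integrating the weight exactly.\<close>

definition pow_moment :: "real \<Rightarrow> real \<Rightarrow> real \<Rightarrow> real \<Rightarrow> real" where
  "pow_moment s p a b = integral {a..b} (\<lambda>x. \<bar>x - s\<bar> powr p * (x - (a + b) / 2))"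

lemma pow_mass_eq:
  assumes "p > -1" "a \<le> b"
  shows "pow_mass s p a b = (signed_powr (b - s) (p + 1) - signed_powr (a - s) (p + 1)) / (p + 1)"
  using has_integral_abs_powr[OF assms] unfolding pow_mass_def by (rule integral_unique)

lemma pow_mass_nonneg:
  assumes "p > -1" "a \<le> b"
  shows "pow_mass s p a b \<ge> 0"
  unfolding pow_mass_def using has_integral_abs_powr[OF assms]
  by (intro integral_nonneg) auto

lemma has_integral_pow_moment:
  assumes "p > -1" "a \<le> b"
  shows "((\<lambda>x. \<bar>x - s\<bar> powr p * (x - (a + b) / 2)) has_integral pow_moment s p a b) {a..b}"
    and "pow_moment s p a b = (\<bar>b - s\<bar> powr (p + 2) - \<bar>a - s\<bar> powr (p + 2)) / (p + 2)
      - ((a + b) / 2 - s) * pow_mass s p a b"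
proof -
  have e: "((\<lambda>x. \<bar>x - s\<bar> powr p * (x - (a + b) / 2)) has_integral
    ((\<bar>b - s\<bar> powr (p + 2) - \<bar>a - s\<bar> powr (p + 2)) / (p + 2)
      - ((a + b) / 2 - s) * pow_mass s p a b)) {a..b}"
    using has_integral_diff[OF has_integral_abs_powr_moment[OF assms, of s]
        has_integral_mult_right[OF has_integral_abs_powr[OF assms, of s], of "(a + b) / 2 - s"]]
    by (subst pow_mass_eq[OF assms]) (simp add: algebra_simps)
  then show "pow_moment s p a b = (\<bar>b - s\<bar> powr (p + 2) - \<bar>a - s\<bar> powr (p + 2)) / (p + 2)
      - ((a + b) / 2 - s) * pow_mass s p a b"
    unfolding pow_moment_def by (rule integral_unique)
  with e show "((\<lambda>x. \<bar>x - s\<bar> powr p * (x - (a + b) / 2)) has_integral pow_moment s p a b) {a..b}"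
    by simp
qed

text \<open>The weight is even about \<open>s\<close>, whereas the offset from the midpoint changes
  sign. The closed form shows this without a change of variables: the even powers trade places, the
  mass is unchanged since \<open>signed_powr\<close> is odd, and its coefficient changes
  sign.\<close>

lemma pow_moment_reflect:
  assumes "p > -1" "a \<le> b"
  shows "pow_moment s p (2 * s - b) (2 * s - a) = - pow_moment s p a b"
proof -
  have o: "signed_powr (- x) (p + 1) = - signed_powr x (p + 1)" for x
    by (simp add: signed_powr_def sgn_minus)
  have "pow_mass s p (2 * s - b) (2 * s - a) = pow_mass s p a b"
    using assms o[of "a - s"] o[of "b - s"] by (simp add: pow_mass_eq algebra_simps)
  moreover have "\<bar>2 * s - b - s\<bar> = \<bar>b - s\<bar>" "\<bar>2 * s - a - s\<bar> = \<bar>a - s\<bar>" by auto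
  moreover have "(2 * s - b + (2 * s - a)) / 2 - s = - ((a + b) / 2 - s)" by (simp add: field_simps)
  ultimately show ?thesis
    using assms by (simp only: has_integral_pow_moment(2)[OF assms(1)] diff_left_mono)
      (simp add: diff_divide_distrib left_diff_distrib)
qed

(* With c = m - s one has c |y|^p (y - c) = |y|^p y (y - c) - |y|^p (y - c)^2, and |y|^p y is
   monotone, so its mean oscillation is controlled by the mass of |y|^p. *)
lemma pow_moment_bound:
  assumes p: "p > -1" and ab: "a \<le> b"
  shows "\<bar>(a + b) / 2 - s\<bar> * \<bar>pow_moment s p a b\<bar> \<le> (p + 2) * (b - a)\<^sup>2 * pow_mass s p a b"
proof -
  define m where "m = (a + b) / 2"
  define k where "k x = signed_powr (x - s) (p + 1)" for x
  have kk: "k x = \<bar>x - s\<bar> powr p * (x - s)" for x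
    using sgn_mult_abs[of "x - s"] by (cases "x = s") (simp_all add: k_def signed_powr_def powr_add)
  have mass: "((\<lambda>x. \<bar>x - s\<bar> powr p) has_integral pow_mass s p a b) {a..b}"
    using has_integral_abs_powr[OF p ab, of s] pow_mass_eq[OF p ab] by simp
  have mom: "((\<lambda>x. (m - s) * (\<bar>x - s\<bar> powr p * (x - m))) has_integral
      (m - s) * pow_moment s p a b) {a..b}"
    using has_integral_pow_moment(1)[OF p ab, of s] unfolding m_def
    by (rule has_integral_mult_right)
  have z: "((\<lambda>x. x - m) has_integral 0) {a..b}"
    unfolding m_def by (rule has_integral_centered[OF ab])
  have osc: "k b - k a = (p + 1) * pow_mass s p a b"
    using p by (simp add: pow_mass_eq[OF p ab] k_def)
  have "((\<lambda>x. (m - s) * (\<bar>x - s\<bar> powr p * (x - m)) - k m * (x - m)) has_integral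
      ((m - s) * pow_moment s p a b - k m * 0)) {a..b}"
    by (intro has_integral_diff mom has_integral_mult_right z)
  then have I: "((\<lambda>x. (m - s) * (\<bar>x - s\<bar> powr p * (x - m)) - k m * (x - m)) has_integral
      ((m - s) * pow_moment s p a b)) {a..b}" by simp
  have J: "((\<lambda>x. (b - a)\<^sup>2 * \<bar>x - s\<bar> powr p + (k b - k a) * (b - a)) has_integral
      ((b - a)\<^sup>2 * pow_mass s p a b + (b - a) * ((k b - k a) * (b - a)))) {a..b}"
    using has_integral_const_real[of "(k b - k a) * (b - a)" a b] ab
    by (intro has_integral_add has_integral_mult_right mass) auto
  have pt: "norm ((m - s) * (\<bar>x - s\<bar> powr p * (x - m)) - k m * (x - m))
      \<le> (b - a)\<^sup>2 * \<bar>x - s\<bar> powr p + (k b - k a) * (b - a)" if x: "x \<in> {a..b}" for x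
  proof -
    have mab: "m \<in> {a..b}" using ab by (simp add: m_def)
    have xm: "\<bar>x - m\<bar> \<le> b - a" using x mab by auto
    then have xm2: "(x - m)\<^sup>2 \<le> (b - a)\<^sup>2"
      by (metis abs_ge_zero power2_abs power_mono)
    have "k a \<le> k x" "k x \<le> k b" "k a \<le> k m" "k m \<le> k b"
      using x mab p by (auto simp: k_def intro!: signed_powr_mono)
    then have kx: "\<bar>k x - k m\<bar> \<le> k b - k a" by linarith
    have "(m - s) * (\<bar>x - s\<bar> powr p * (x - m)) - k m * (x - m)
        = (k x - k m) * (x - m) - (x - m)\<^sup>2 * \<bar>x - s\<bar> powr p"
      unfolding kk by (simp add: algebra_simps power2_eq_square)
    also have "norm \<dots> \<le> \<bar>k x - k m\<bar> * \<bar>x - m\<bar> + (x - m)\<^sup>2 * \<bar>x - s\<bar> powr p"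
      unfolding real_norm_def
      by (rule order_trans[OF abs_triangle_ineq4]) (simp add: abs_mult)
    also have "\<dots> \<le> (k b - k a) * (b - a) + (b - a)\<^sup>2 * \<bar>x - s\<bar> powr p"
      using kx xm xm2 by (intro add_mono mult_mono mult_right_mono) auto
    finally show ?thesis by simp
  qed
  \<comment> \<open>In the factor p + 2, the 1 stems from the quadratic term and the p + 1 from the
    increment of \<open>k\<close> over the cell.\<close>
  have "norm ((m - s) * pow_moment s p a b)
      \<le> (b - a)\<^sup>2 * pow_mass s p a b + (b - a) * ((k b - k a) * (b - a))"
    by (rule has_integral_norm_bound[OF I J pt])
  also have "\<dots> = (p + 2) * (b - a)\<^sup>2 * pow_mass s p a b"
    unfolding osc by (simp add: algebra_simps power2_eq_square)
  finally show ?thesis by (simp add: abs_mult m_def)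
qed

section \<open>Error on a single cell\<close>

text \<open>Of \<open>\<phi>\<close> only its size and oscillation enter, since x^\<alpha> need not
  even be differentiable at 0. Smoothness is demanded of \<open>\<psi>\<close> and \<open>g\<close>
  alone.\<close>

lemma quadrature_error_regular:
  fixes \<phi> \<psi> :: "real \<Rightarrow> real" and g :: "real \<Rightarrow> complex"
  assumes ab: "a < b" and B: "B \<ge> 0"
    and cont: "continuous_on {a..b} \<phi>" "continuous_on {a..b} \<psi>" "continuous_on {a..b} g"
    and osc: "\<And>x y. x \<in> {a..b} \<Longrightarrow> y \<in> {a..b} \<Longrightarrow> \<bar>\<phi> x - \<phi> y\<bar> \<le> \<omega>"
    and \<Phi>: "\<And>x. x \<in> {a..b} \<Longrightarrow> \<bar>\<phi> x\<bar> \<le> \<Phi>"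
    and \<psi>: "\<And>x. x \<in> {a..b} \<Longrightarrow> \<bar>\<psi> x\<bar> \<le> B"
      "\<And>x y. x \<in> {a..b} \<Longrightarrow> y \<in> {a..b} \<Longrightarrow> \<bar>\<psi> x - \<psi> y\<bar> \<le> B * \<bar>x - y\<bar>"
    and g: "\<And>x. x \<in> {a..b} \<Longrightarrow> norm (g x) \<le> B"
      "\<And>x y. x \<in> {a..b} \<Longrightarrow> y \<in> {a..b} \<Longrightarrow> norm (g x - g y) \<le> B * \<bar>x - y\<bar>"
      "\<And>x y. x \<in> {a..b} \<Longrightarrow> y \<in> {a..b} \<Longrightarrow>
        norm (g x - g y - (x - y) *\<^sub>R g' y) \<le> B * (x - y)\<^sup>2"
  shows "norm (integral {a..b} (\<lambda>x. (\<phi> x * \<psi> x) *\<^sub>R g x)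
      - (integral {a..b} \<phi> * integral {a..b} \<psi> / (b - a)) *\<^sub>R g ((a + b) / 2))
    \<le> 2 * B\<^sup>2 * (b - a)\<^sup>2 * (\<omega> + \<Phi> * (b - a))"
proof -
  define m where "m = (a + b) / 2"
  define c where "c = integral {a..b} \<phi> / (b - a)"
  define h where "h = b - a"
  have m: "m \<in> {a..b}" and h: "h > 0" using ab by (auto simp: m_def h_def)
  have int\<phi>: "(\<phi> has_integral c * h) {a..b}"
    using integrable_integral[OF integrable_continuous_real[OF cont(1)]] h
    by (simp add: c_def h_def)
  have const: "((\<lambda>_. k) has_integral h *\<^sub>R k) {a..b}" for k :: "'v::euclidean_space"
    using has_integral_const_real[of k a b] ab by (simp add: h_def)
  have c1: "\<bar>\<phi> x - c\<bar> \<le> \<omega>" if x: "x \<in> {a..b}" for x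
  proof -
    have "((\<lambda>y. \<phi> x - \<phi> y) has_integral (h *\<^sub>R \<phi> x - c * h)) {a..b}"
      by (intro has_integral_diff const int\<phi>)
    from has_integral_norm_bound[OF this const[of \<omega>]]
    have "norm (h *\<^sub>R \<phi> x - c * h) \<le> h *\<^sub>R \<omega>"
      using osc[OF x] by auto
    moreover have "h *\<^sub>R \<phi> x - c * h = h * (\<phi> x - c)" by (simp add: algebra_simps)
    ultimately have "h * \<bar>\<phi> x - c\<bar> \<le> h * \<omega>"
      using h by (simp add: abs_mult)
    then show ?thesis using h by simp
  qed
  have c2: "\<bar>c\<bar> \<le> \<Phi>"
  proof -
    have "norm (c * h) \<le> h *\<^sub>R \<Phi>"
      by (rule has_integral_norm_bound[OF int\<phi> const]) (use \<Phi> in auto)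
    then have "h * \<bar>c\<bar> \<le> h * \<Phi>" using h by (simp add: abs_mult mult.commute)
    then show ?thesis using h by simp
  qed
  define f where "f x = (\<phi> x * \<psi> x) *\<^sub>R g x - (c * \<psi> x) *\<^sub>R g m" for x
  \<comment> \<open>Both summands integrate to zero, the first because \<open>c\<close> is the mean
    of \<open>\<phi>\<close>, the second because \<open>m\<close> is the midpoint. What remains of
    \<open>f\<close> after removing them is \<open>\<phi> x - c\<close> times a first-order
    difference, plus \<open>c\<close> times second-order terms.\<close>
  define z where "z x = (\<phi> x - c) *\<^sub>R (\<psi> m *\<^sub>R g m) + (x - m) *\<^sub>R ((c * \<psi> m) *\<^sub>R g' m)" for x
  have If: "(f has_integral (integral {a..b} (\<lambda>x. (\<phi> x * \<psi> x) *\<^sub>R g x)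
      - (c * integral {a..b} \<psi>) *\<^sub>R g m)) {a..b}"
    unfolding f_def
    by (intro has_integral_diff integrable_integral integrable_continuous_real
        has_integral_scaleR_left has_integral_mult_right continuous_intros cont)
  have Iz: "(z has_integral ((h *\<^sub>R 0) *\<^sub>R (\<psi> m *\<^sub>R g m) + 0 *\<^sub>R ((c * \<psi> m) *\<^sub>R g' m))) {a..b}"
    unfolding z_def
  proof (intro has_integral_add has_integral_scaleR_left)
    show "((\<lambda>x. \<phi> x - c) has_integral h *\<^sub>R 0) {a..b}"
      using has_integral_diff[OF int\<phi> const[of c]] by (simp add: mult.commute)
    show "((\<lambda>x. x - m) has_integral 0) {a..b}"
      using has_integral_centered[of a b] ab by (simp add: m_def)
  qed
  have I: "((\<lambda>x. f x - z x) has_integral (integral {a..b} (\<lambda>x. (\<phi> x * \<psi> x) *\<^sub>R g x)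
      - (c * integral {a..b} \<psi>) *\<^sub>R g m)) {a..b}"
    using has_integral_diff[OF If Iz] by simp
  have "norm (f x - z x) \<le> 2 * B\<^sup>2 * h * (\<omega> + \<Phi> * h)" if x: "x \<in> {a..b}" for x
  proof -
    have xm: "\<bar>x - m\<bar> \<le> h" using x m by (auto simp: h_def)
    then have xm2: "(x - m)\<^sup>2 \<le> h\<^sup>2" by (metis abs_ge_zero power2_abs power_mono)
    have d\<psi>: "\<bar>\<psi> x - \<psi> m\<bar> \<le> B * h"
      using \<psi>(2)[OF x m] mult_left_mono[OF xm B] by linarith
    have dg: "norm (g x - g m) \<le> B * h"
      using g(2)[OF x m] mult_left_mono[OF xm B] by linarith
    have tg: "norm (g x - g m - (x - m) *\<^sub>R g' m) \<le> B * h\<^sup>2"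
      using g(3)[OF x m] mult_left_mono[OF xm2 B] by linarith
    have \<omega>0: "\<omega> \<ge> 0" "\<Phi> \<ge> 0" using c1[OF x] c2 by linarith+
    have e: "f x - z x = (\<phi> x - c) *\<^sub>R (\<psi> x *\<^sub>R (g x - g m) + (\<psi> x - \<psi> m) *\<^sub>R g m)
      + c *\<^sub>R ((\<psi> x - \<psi> m) *\<^sub>R (g x - g m) + \<psi> m *\<^sub>R (g x - g m - (x - m) *\<^sub>R g' m))"
      unfolding f_def z_def by (simp add: algebra_simps scaleR_left_diff_distrib)
    have n1: "norm (\<psi> x *\<^sub>R (g x - g m) + (\<psi> x - \<psi> m) *\<^sub>R g m) \<le> B * (B * h) + (B * h) * B"
      unfolding norm_scaleR using \<psi>(1)[OF x] d\<psi> dg g(1)[OF m] B h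
      by (intro norm_triangle_mono) (auto intro!: mult_mono)
    have n2: "norm ((\<psi> x - \<psi> m) *\<^sub>R (g x - g m) + \<psi> m *\<^sub>R (g x - g m - (x - m) *\<^sub>R g' m))
        \<le> (B * h) * (B * h) + B * (B * h\<^sup>2)"
      unfolding norm_scaleR using \<psi>(1)[OF m] d\<psi> dg tg B h
      by (intro norm_triangle_mono) (auto intro!: mult_mono)
    have "norm (f x - z x) \<le> \<omega> * (B * (B * h) + (B * h) * B) + \<Phi> * ((B * h) * (B * h) + B * (B * h\<^sup>2))"
      unfolding e using c1[OF x] c2 n1 n2 \<omega>0
      by (intro norm_triangle_mono) (auto intro!: mult_mono)
    also have "\<dots> = 2 * B\<^sup>2 * h * (\<omega> + \<Phi> * h)" by (simp add: algebra_simps power2_eq_square)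
    finally show ?thesis .
  qed
  from has_integral_norm_bound[OF I const this]
  have "norm (integral {a..b} (\<lambda>x. (\<phi> x * \<psi> x) *\<^sub>R g x)
      - (c * integral {a..b} \<psi>) *\<^sub>R g m) \<le> h *\<^sub>R (2 * B\<^sup>2 * h * (\<omega> + \<Phi> * h))" .
  then show ?thesis by (simp add: h_def m_def c_def power2_eq_square mult_ac)
qed

text \<open>Once the linear term with slope \<open>F' m\<close> is removed, the integrand is the
  weight times a Taylor remainder plus the defect of the sampled value against \<open>F m\<close>,
  each of order h^2; this gives 2 out of p + 4. The other p + 2 is the price of moving the slope
  from \<open>m\<close> to the point \<open>s\<close> shared by all cells.\<close>

lemma quadrature_error_singular:
  fixes F g :: "real \<Rightarrow> complex" and a b :: real
  defines "m \<equiv> (a + b) / 2" and "h \<equiv> b - a"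
  assumes p: "p > -1" and ab: "a \<le> b" and B: "B \<ge> 0"
    and F: "continuous_on {a..b} F"
      "\<And>x. x \<in> {a..b} \<Longrightarrow> norm (F x - F m - (x - m) *\<^sub>R F' m) \<le> B * (x - m)\<^sup>2"
      "norm (F' m - F' s) \<le> B * \<bar>m - s\<bar>"
    and c: "norm (F m - c *\<^sub>R g m) \<le> B * h\<^sup>2"
  shows "norm (integral {a..b} (\<lambda>x. \<bar>x - s\<bar> powr p *\<^sub>R F x)
      - (c * pow_mass s p a b) *\<^sub>R g m - pow_moment s p a b *\<^sub>R F' s)
    \<le> B * (p + 4) * h\<^sup>2 * pow_mass s p a b"
proof -
  define w where "w x = \<bar>x - s\<bar> powr p" for x
  define P where "P = pow_mass s p a b"
  define D where "D = pow_moment s p a b"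
  have mass: "(w has_integral P) {a..b}"
    using has_integral_abs_powr[OF p ab, of s] pow_mass_eq[OF p ab] by (simp add: w_def[abs_def] P_def)
  have mom: "((\<lambda>x. w x * (x - m)) has_integral D) {a..b}"
    using has_integral_pow_moment(1)[OF p ab, of s] by (simp add: w_def[abs_def] m_def D_def)
  have P0: "P \<ge> 0" unfolding P_def by (rule pow_mass_nonneg[OF p ab])
  have wF: "(\<lambda>x. w x *\<^sub>R F x) integrable_on {a..b}"
    using has_integral_integrable[OF mass] F(1)
    by (intro integrable_nonneg_scaleR_continuous) (simp_all, simp add: w_def)
  have I: "((\<lambda>x. w x *\<^sub>R F x - w x *\<^sub>R (c *\<^sub>R g m) - (w x * (x - m)) *\<^sub>R F' m) has_integral
      (integral {a..b} (\<lambda>x. w x *\<^sub>R F x) - P *\<^sub>R (c *\<^sub>R g m) - D *\<^sub>R F' m)) {a..b}"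
    by (intro has_integral_diff has_integral_scaleR_left mass mom integrable_integral wF)
  have J: "((\<lambda>x. (2 * B * h\<^sup>2) * w x) has_integral (2 * B * h\<^sup>2) * P) {a..b}"
    by (intro has_integral_mult_right mass)
  have "norm (integral {a..b} (\<lambda>x. w x *\<^sub>R F x) - P *\<^sub>R (c *\<^sub>R g m) - D *\<^sub>R F' m) \<le> (2 * B * h\<^sup>2) * P"
  proof (rule has_integral_norm_bound[OF I J])
    fix x assume x: "x \<in> {a..b}"
    have "\<bar>x - m\<bar> \<le> h" using x by (auto simp: h_def m_def field_simps abs_le_iff)
    then have xm2: "(x - m)\<^sup>2 \<le> h\<^sup>2" by (metis abs_ge_zero power2_abs power_mono)
    have "norm ((F x - F m - (x - m) *\<^sub>R F' m) + (F m - c *\<^sub>R g m)) \<le> B * h\<^sup>2 + B * h\<^sup>2"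
      using F(2)[OF x] c mult_left_mono[OF xm2 B] by (intro norm_triangle_mono) auto
    then have "w x * norm ((F x - F m - (x - m) *\<^sub>R F' m) + (F m - c *\<^sub>R g m)) \<le> w x * (2 * B * h\<^sup>2)"
      by (intro mult_left_mono) (auto simp: w_def)
    moreover have "w x *\<^sub>R F x - w x *\<^sub>R (c *\<^sub>R g m) - (w x * (x - m)) *\<^sub>R F' m
      = w x *\<^sub>R ((F x - F m - (x - m) *\<^sub>R F' m) + (F m - c *\<^sub>R g m))"
      by (simp add: algebra_simps)
    moreover have "\<bar>w x\<bar> = w x" by (simp add: w_def)
    ultimately show "norm (w x *\<^sub>R F x - w x *\<^sub>R (c *\<^sub>R g m) - (w x * (x - m)) *\<^sub>R F' m)
        \<le> 2 * B * h\<^sup>2 * w x"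
      by (simp add: mult_ac)
  qed
  moreover have "norm (D *\<^sub>R (F' m - F' s)) \<le> B * ((p + 2) * h\<^sup>2 * P)"
  proof -
    \<comment> \<open>The trivial estimate of \<open>D\<close> by \<open>h * P\<close> would lose
      one order of h on cells at a fixed distance from \<open>s\<close>;
      \<open>pow_moment_bound\<close> absorbs the factor \<open>\<bar>m - s\<bar>\<close>
      instead.\<close>
    have "norm (D *\<^sub>R (F' m - F' s)) \<le> \<bar>D\<bar> * (B * \<bar>m - s\<bar>)"
      using F(3) by (simp add: mult_left_mono)
    also have "\<dots> = B * (\<bar>m - s\<bar> * \<bar>D\<bar>)" by simp
    also have "\<dots> \<le> B * ((p + 2) * h\<^sup>2 * P)"
      using pow_moment_bound[OF p ab, of s] B
      by (intro mult_left_mono) (auto simp: D_def P_def m_def h_def)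
    finally show ?thesis .
  qed
  ultimately have "norm ((integral {a..b} (\<lambda>x. w x *\<^sub>R F x) - P *\<^sub>R (c *\<^sub>R g m) - D *\<^sub>R F' m)
      + D *\<^sub>R (F' m - F' s)) \<le> (2 * B * h\<^sup>2) * P + B * ((p + 2) * h\<^sup>2 * P)"
    by (intro norm_triangle_mono)
  also have "(integral {a..b} (\<lambda>x. w x *\<^sub>R F x) - P *\<^sub>R (c *\<^sub>R g m) - D *\<^sub>R F' m)
      + D *\<^sub>R (F' m - F' s)
    = integral {a..b} (\<lambda>x. w x *\<^sub>R F x) - (c * P) *\<^sub>R g m - D *\<^sub>R F' s"
    by (simp add: algebra_simps)
  also have "(2 * B * h\<^sup>2) * P + B * ((p + 2) * h\<^sup>2 * P) = B * (p + 4) * h\<^sup>2 * P"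
    by (simp add: algebra_simps)
  finally show ?thesis unfolding w_def P_def D_def .
qed

text \<open>The linear Taylor term has mean zero over the cell. The casts to complex numbers are
  there because the Taylor bounds come from \<open>C2_on_interval\<close>, which speaks of
  complex-valued functions.\<close>

lemma mean_error:
  fixes \<phi> :: "real \<Rightarrow> real" and f' :: "real \<Rightarrow> complex" and a b :: real
  defines "m \<equiv> (a + b) / 2"
  assumes ab: "a < b" and cont: "continuous_on {a..b} \<phi>" and B: "B \<ge> 0"
    and T: "\<And>x. x \<in> {a..b} \<Longrightarrow>
      norm (complex_of_real (\<phi> x) - of_real (\<phi> m) - (x - m) *\<^sub>R f' m) \<le> B * (x - m)\<^sup>2"
  shows "\<bar>\<phi> m - integral {a..b} \<phi> / (b - a)\<bar> \<le> B * (b - a)\<^sup>2"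
proof -
  define h where "h = b - a"
  have h: "h > 0" using ab by (simp add: h_def)
  have const: "((\<lambda>_. k) has_integral h *\<^sub>R k) {a..b}" for k :: "'v::euclidean_space"
    using has_integral_const_real[of k a b] ab by (simp add: h_def)
  have I: "((\<lambda>x. complex_of_real (\<phi> x)) has_integral of_real (integral {a..b} \<phi>)) {a..b}"
    using integrable_integral[OF integrable_continuous_real[OF cont]] by (rule has_integral_of_real)
  have "((\<lambda>x. complex_of_real (\<phi> x) - of_real (\<phi> m) - (x - m) *\<^sub>R f' m) has_integral
      (of_real (integral {a..b} \<phi>) - h *\<^sub>R of_real (\<phi> m) - 0 *\<^sub>R f' m)) {a..b}"
    using has_integral_centered[of a b] ab unfolding m_def
    by (intro has_integral_diff I const has_integral_scaleR_left) auto
  moreover have "of_real (integral {a..b} \<phi>) - h *\<^sub>R of_real (\<phi> m) - 0 *\<^sub>R f' m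
      = complex_of_real (integral {a..b} \<phi> - h * \<phi> m)" by (simp add: scaleR_conv_of_real)
  ultimately have I2: "((\<lambda>x. complex_of_real (\<phi> x) - of_real (\<phi> m) - (x - m) *\<^sub>R f' m) has_integral
      complex_of_real (integral {a..b} \<phi> - h * \<phi> m)) {a..b}" by (simp only:)
  have "norm (complex_of_real (integral {a..b} \<phi> - h * \<phi> m)) \<le> h *\<^sub>R (B * h\<^sup>2)"
  proof (rule has_integral_norm_bound[OF I2 const])
    show "norm (complex_of_real (\<phi> x) - of_real (\<phi> m) - (x - m) *\<^sub>R f' m) \<le> B * h\<^sup>2"
      if x: "x \<in> {a..b}" for x
    proof -
      have "\<bar>x - m\<bar> \<le> h" using x by (auto simp: h_def m_def field_simps abs_le_iff)
      then have "(x - m)\<^sup>2 \<le> h\<^sup>2" by (metis abs_ge_zero power2_abs power_mono)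
      from mult_left_mono[OF this B] T[OF x] show ?thesis by linarith
    qed
  qed
  then have "\<bar>integral {a..b} \<phi> - h * \<phi> m\<bar> \<le> h * (B * h\<^sup>2)"
    by (simp only: norm_of_real real_scaleR_def)
  moreover have "\<bar>integral {a..b} \<phi> - h * \<phi> m\<bar> = h * \<bar>\<phi> m - integral {a..b} \<phi> / h\<bar>"
  proof -
    have "integral {a..b} \<phi> - h * \<phi> m = - (h * (\<phi> m - integral {a..b} \<phi> / h))"
      using h by (simp add: field_simps)
    then show ?thesis using h by (simp add: abs_mult del: minus_diff_eq)
  qed
  ultimately show ?thesis using h by (simp add: h_def)
qed

text \<open>Both weights are integrated exactly but separately, and the division by the cell length
  is the factor 1/h of the rule.\<close>

definition cell_error ::
  "real \<Rightarrow> real \<Rightarrow> (real \<Rightarrow> real) \<Rightarrow> (real \<Rightarrow> complex) \<Rightarrow> real \<Rightarrow> real \<Rightarrow> complex" where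
  "cell_error s p \<phi> g a b = integral {a..b} (\<lambda>x. (\<bar>x - s\<bar> powr p * \<phi> x) *\<^sub>R g x)
    - (integral {a..b} \<phi> * pow_mass s p a b / (b - a)) *\<^sub>R g ((a + b) / 2)"

text \<open>\<open>mono\<close> is monotonicity in a form that fits rising and falling
  \<open>\<phi>\<close> alike; it turns the oscillation into an increment that can telescope. The
  constant may depend on \<open>d\<close> but not on the cell.\<close>

lemma cell_error_far:
  fixes \<phi> :: "real \<Rightarrow> real" and g :: "real \<Rightarrow> complex"
  assumes d: "d > 0" and cont: "continuous_on {l..u} \<phi>" and g: "C2_on_interval l u g"
    and mono: "\<And>a b x y. \<lbrakk>l \<le> a; b \<le> u; x \<in> {a..b}; y \<in> {a..b}\<rbrakk> \<Longrightarrow> \<bar>\<phi> x - \<phi> y\<bar> \<le> \<bar>\<phi> b - \<phi> a\<bar>"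
  obtains C where "C \<ge> 0" "\<And>a b. \<lbrakk>l \<le> a; a < b; b \<le> u; b \<le> s - d \<or> s + d \<le> a\<rbrakk> \<Longrightarrow>
    norm (cell_error s p \<phi> g a b) \<le> C * (b - a)\<^sup>2 * (\<bar>\<phi> b - \<phi> a\<bar> + (b - a))"
proof -
  obtain g' Bg where Bg: "Bg \<ge> 0" "\<And>x. x \<in> {l..u} \<Longrightarrow> norm (g x) \<le> Bg"
    "\<And>x y. x \<in> {l..u} \<Longrightarrow> y \<in> {l..u} \<Longrightarrow> norm (g x - g y) \<le> Bg * \<bar>x - y\<bar>"
    "\<And>x y. x \<in> {l..u} \<Longrightarrow> y \<in> {l..u} \<Longrightarrow> norm (g x - g y - (x - y) *\<^sub>R g' y) \<le> Bg * (x - y)\<^sup>2"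
    by (rule C2_on_interval_bounds[OF g]) blast
  define \<psi> where "\<psi> x = \<bar>x - s\<bar> powr p" for x
  have \<psi>bound: "\<exists>B\<ge>0. (\<forall>x\<in>{a..b}. \<bar>\<psi> x\<bar> \<le> B) \<and> (\<forall>x\<in>{a..b}. \<forall>y\<in>{a..b}. \<bar>\<psi> x - \<psi> y\<bar> \<le> B * \<bar>x - y\<bar>)"
    if "f holomorphic_on UNIV" "\<And>x. x \<in> {a..b} \<Longrightarrow> f (of_real x) = of_real \<bar>x - s\<bar>"
      "\<And>x. x \<in> {a..b} \<Longrightarrow> \<bar>x - s\<bar> > 0" for f a b
  proof -
    have "C2_on_interval a b (\<lambda>x. of_real (\<psi> x))"
      unfolding \<psi>_def by (rule C2_on_interval_powr[OF that])
    then show ?thesis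
    proof (rule C2_on_interval_bounds, goal_cases)
      case (1 f' B)
      then show ?thesis
        by (intro exI[of _ B]) (auto simp del: of_real_diff simp: of_real_diff[symmetric])
    qed
  qed
  \<comment> \<open>|x - s| has no holomorphic extension across \<open>s\<close>, so the two sides
    are treated apart, with s - z on the left and z - s on the right.\<close>
  obtain B1 where B1: "B1 \<ge> 0" "\<And>x. x \<in> {l..s-d} \<Longrightarrow> \<bar>\<psi> x\<bar> \<le> B1"
    "\<And>x y. x \<in> {l..s-d} \<Longrightarrow> y \<in> {l..s-d} \<Longrightarrow> \<bar>\<psi> x - \<psi> y\<bar> \<le> B1 * \<bar>x - y\<bar>"
    using \<psi>bound[of "\<lambda>z. of_real s - z" l "s - d"] d by (fastforce intro!: holomorphic_intros)
  obtain B2 where B2: "B2 \<ge> 0" "\<And>x. x \<in> {s+d..u} \<Longrightarrow> \<bar>\<psi> x\<bar> \<le> B2"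
    "\<And>x y. x \<in> {s+d..u} \<Longrightarrow> y \<in> {s+d..u} \<Longrightarrow> \<bar>\<psi> x - \<psi> y\<bar> \<le> B2 * \<bar>x - y\<bar>"
    using \<psi>bound[of "\<lambda>z. z - of_real s" "s + d" u] d by (fastforce intro!: holomorphic_intros)
  obtain \<Phi> where \<Phi>: "\<And>x. x \<in> {l..u} \<Longrightarrow> \<bar>\<phi> x\<bar> \<le> \<Phi>"
    using compact_imp_bounded[OF compact_continuous_image[OF cont compact_Icc]]
    unfolding bounded_iff by (metis imageI real_norm_def)
  define B where "B = Bg + B1 + B2"
  \<comment> \<open>One factor must dominate the coefficient 1 of the increment and the coefficient
    \<open>\<Phi>\<close> of the length.\<close>
  define A where "A = max 1 \<Phi>"
  have B: "B \<ge> 0" "Bg \<le> B" "B1 \<le> B" "B2 \<le> B" using Bg B1 B2 by (auto simp: B_def)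
  have main: "norm (cell_error s p \<phi> g a b) \<le> (2 * B\<^sup>2 * A) * (b - a)\<^sup>2 * (\<bar>\<phi> b - \<phi> a\<bar> + (b - a))"
    if ab: "l \<le> a" "a < b" "b \<le> u" "b \<le> s - d \<or> s + d \<le> a" for a b
  proof -
    have sub: "{a..b} \<subseteq> {l..u}" using ab by auto
    have Bup: "\<And>t v. t \<le> Bg * v \<Longrightarrow> 0 \<le> v \<Longrightarrow> t \<le> B * v"
      "\<And>t v. t \<le> B1 * v \<Longrightarrow> 0 \<le> v \<Longrightarrow> t \<le> B * v"
      "\<And>t v. t \<le> B2 * v \<Longrightarrow> 0 \<le> v \<Longrightarrow> t \<le> B * v"
      using B mult_right_mono order_trans by blast+
    have \<psi>1: "\<bar>\<psi> x\<bar> \<le> B" if "x \<in> {a..b}" for x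
      using ab(4)
    proof
      assume "b \<le> s - d"
      then have "\<bar>\<psi> x\<bar> \<le> B1" using ab that by (intro B1) auto
      then show ?thesis using B by linarith
    next
      assume "s + d \<le> a"
      then have "\<bar>\<psi> x\<bar> \<le> B2" using ab that by (intro B2) auto
      then show ?thesis using B by linarith
    qed
    have \<psi>2: "\<bar>\<psi> x - \<psi> y\<bar> \<le> B * \<bar>x - y\<bar>" if "x \<in> {a..b}" "y \<in> {a..b}" for x y
      using ab(4)
    proof
      assume "b \<le> s - d"
      then have "\<bar>\<psi> x - \<psi> y\<bar> \<le> B1 * \<bar>x - y\<bar>" using ab that by (intro B1) auto
      then show ?thesis by (rule Bup) simp
    next
      assume "s + d \<le> a"
      then have "\<bar>\<psi> x - \<psi> y\<bar> \<le> B2 * \<bar>x - y\<bar>" using ab that by (intro B2) auto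
      then show ?thesis by (rule Bup) simp
    qed
    have "norm (integral {a..b} (\<lambda>x. (\<phi> x * \<psi> x) *\<^sub>R g x)
        - (integral {a..b} \<phi> * integral {a..b} \<psi> / (b - a)) *\<^sub>R g ((a + b) / 2))
      \<le> 2 * B\<^sup>2 * (b - a)\<^sup>2 * (\<bar>\<phi> b - \<phi> a\<bar> + \<Phi> * (b - a))"
    proof (rule quadrature_error_regular)
      show "continuous_on {a..b} \<psi>" unfolding \<psi>_def
        using ab d by (auto intro!: continuous_intros)
      show "norm (g x) \<le> B" if "x \<in> {a..b}" for x using Bg(2) sub that B by fastforce
      show "norm (g x - g y) \<le> B * \<bar>x - y\<bar>" if "x \<in> {a..b}" "y \<in> {a..b}" for x y
        using Bg(3) sub that by (intro Bup) auto
      show "norm (g x - g y - (x - y) *\<^sub>R g' y) \<le> B * (x - y)\<^sup>2" if "x \<in> {a..b}" "y \<in> {a..b}" for x y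
        using Bg(4) sub that by (intro Bup) auto
      show "\<bar>\<phi> x - \<phi> y\<bar> \<le> \<bar>\<phi> b - \<phi> a\<bar>" if "x \<in> {a..b}" "y \<in> {a..b}" for x y
        using mono ab that by blast
    qed (use ab B \<psi>1 \<psi>2 \<Phi> sub cont continuous_on_subset C2_on_interval_continuous[OF g] in blast)+
    also have "\<dots> \<le> 2 * B\<^sup>2 * (b - a)\<^sup>2 * (A * \<bar>\<phi> b - \<phi> a\<bar> + A * (b - a))"
    proof (intro mult_left_mono add_mono mult_right_mono)
      show "\<bar>\<phi> b - \<phi> a\<bar> \<le> A * \<bar>\<phi> b - \<phi> a\<bar>"
        using mult_right_mono[of 1 A "\<bar>\<phi> b - \<phi> a\<bar>"] by (simp add: A_def)
    qed (use ab in \<open>auto simp: A_def\<close>)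
    finally show ?thesis
      unfolding cell_error_def pow_mass_def \<psi>_def by (simp add: algebra_simps)
  qed
  show ?thesis by (rule that[of "2 * B\<^sup>2 * A"]) (use main in \<open>auto simp: A_def\<close>)
qed

text \<open>\<open>F\<close> and \<open>F'\<close> come from outside and are controlled on the whole
  window around \<open>s\<close>: \<open>s\<close> may lie beyond [l, u], and both halves of [0, pi]
  must receive the same \<open>F' s\<close>. Smoothness of \<open>\<phi>\<close> serves to compare
  its mean with its midpoint value, whence the term \<open>Bf * Bg\<close>.\<close>

lemma cell_error_near:
  fixes \<phi> :: "real \<Rightarrow> real" and F F' g :: "real \<Rightarrow> complex"
  assumes p: "p > -1" and d: "d > 0" and cont: "continuous_on {l..u} \<phi>" and g: "C2_on_interval l u g"
    and \<phi>: "C2_on_interval (max l (s - d)) (min u (s + d)) (\<lambda>x. of_real (\<phi> x))"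
    and BF: "BF \<ge> 0" and F: "\<And>x. x \<in> {l..u} \<Longrightarrow> F x = \<phi> x *\<^sub>R g x"
      "\<And>x y. x \<in> {s-d..s+d} \<Longrightarrow> y \<in> {s-d..s+d} \<Longrightarrow> norm (F' x - F' y) \<le> BF * \<bar>x - y\<bar>"
      "\<And>x y. x \<in> {s-d..s+d} \<Longrightarrow> y \<in> {s-d..s+d} \<Longrightarrow>
        norm (F x - F y - (x - y) *\<^sub>R F' y) \<le> BF * (x - y)\<^sup>2"
  obtains C where "C \<ge> 0" "\<And>a b. \<lbrakk>l \<le> a; a < b; b \<le> u; s - d \<le> a; b \<le> s + d\<rbrakk> \<Longrightarrow>
    norm (cell_error s p \<phi> g a b - pow_moment s p a b *\<^sub>R F' s)
      \<le> C * (b - a)\<^sup>2 * pow_mass s p a b"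
proof -
  obtain g' Bg where Bg: "Bg \<ge> 0" "\<And>x. x \<in> {l..u} \<Longrightarrow> norm (g x) \<le> Bg"
    by (rule C2_on_interval_bounds[OF g]) blast
  obtain f' Bf where Bf: "Bf \<ge> 0"
    "\<And>x y. x \<in> {max l (s - d)..min u (s + d)} \<Longrightarrow> y \<in> {max l (s - d)..min u (s + d)} \<Longrightarrow>
      norm (complex_of_real (\<phi> x) - of_real (\<phi> y) - (x - y) *\<^sub>R f' y) \<le> Bf * (x - y)\<^sup>2"
    by (rule C2_on_interval_bounds[OF \<phi>]) blast
  define B where "B = BF + Bf * Bg"
  have B: "B \<ge> 0" "BF \<le> B" "Bf * Bg \<le> B" using BF Bf Bg by (auto simp: B_def)
  have main: "norm (cell_error s p \<phi> g a b - pow_moment s p a b *\<^sub>R F' s)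
      \<le> (B * (p + 4)) * (b - a)\<^sup>2 * pow_mass s p a b"
    if ab: "l \<le> a" "a < b" "b \<le> u" "s - d \<le> a" "b \<le> s + d" for a b
  proof -
    define m where "m = (a + b) / 2"
    define c where "c = integral {a..b} \<phi> / (b - a)"
    have m: "m \<in> {a..b}" using ab by (simp add: m_def)
    have sub: "{a..b} \<subseteq> {l..u}" "{a..b} \<subseteq> {s-d..s+d}" "{a..b} \<subseteq> {max l (s - d)..min u (s + d)}"
      using ab by auto
    have cont': "continuous_on {a..b} \<phi>" using cont sub(1) by (rule continuous_on_subset)
    have Fc: "continuous_on {a..b} F"
    proof (rule continuous_on_eq)
      show "continuous_on {a..b} (\<lambda>x. \<phi> x *\<^sub>R g x)"
        by (intro continuous_intros cont' continuous_on_subset[OF C2_on_interval_continuous[OF g] sub(1)])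
    qed (use F(1) sub in auto)
    have cm: "\<bar>\<phi> m - c\<bar> \<le> Bf * (b - a)\<^sup>2"
      unfolding c_def m_def by (rule mean_error[where f' = f'])
        (use ab cont' Bf sub m[unfolded m_def] in blast)+
    have "F m - c *\<^sub>R g m = (\<phi> m - c) *\<^sub>R g m"
      using F(1)[of m] sub m by (simp add: scaleR_left_diff_distrib)
    also have "norm \<dots> \<le> (Bf * (b - a)\<^sup>2) * Bg"
      using cm Bg m sub by (auto intro!: mult_mono)
    also have "\<dots> \<le> B * (b - a)\<^sup>2"
      using mult_right_mono[OF B(3), of "(b - a)\<^sup>2"] by (simp add: mult_ac)
    finally have cF: "norm (F m - c *\<^sub>R g m) \<le> B * (b - a)\<^sup>2" .
    have "norm (integral {a..b} (\<lambda>x. \<bar>x - s\<bar> powr p *\<^sub>R F x)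
        - (c * pow_mass s p a b) *\<^sub>R g m - pow_moment s p a b *\<^sub>R F' s)
      \<le> B * (p + 4) * (b - a)\<^sup>2 * pow_mass s p a b"
      unfolding m_def
    proof (rule quadrature_error_singular[OF p _ B(1) Fc, folded m_def])
      show "norm (F x - F m - (x - m) *\<^sub>R F' m) \<le> B * (x - m)\<^sup>2" if "x \<in> {a..b}" for x
        using F(3)[of x m] that m sub(2) mult_right_mono[OF B(2), of "(x - m)\<^sup>2"] by fastforce
      show "norm (F' m - F' s) \<le> B * \<bar>m - s\<bar>"
        using F(2)[of m s] m sub(2) d mult_right_mono[OF B(2), of "\<bar>m - s\<bar>"] by fastforce
    qed (use ab cF in \<open>auto simp: m_def\<close>)
    moreover have "integral {a..b} (\<lambda>x. (\<bar>x - s\<bar> powr p * \<phi> x) *\<^sub>R g x)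
        = integral {a..b} (\<lambda>x. \<bar>x - s\<bar> powr p *\<^sub>R F x)"
      using F(1) sub by (intro integral_cong) (auto simp: subset_iff)
    ultimately show ?thesis by (simp add: cell_error_def c_def m_def)
  qed
  show ?thesis by (rule that[of "B * (p + 4)"]) (use main p B in auto)
qed

section \<open>Summation over the grid\<close>

text \<open>Reflection in the grid point \<open>s\<close> permutes the cells and flips each moment,
  so the sum equals its own negative. \<open>k \<le> M\<close> keeps the subtraction of naturals
  from truncating.\<close>

lemma sum_pow_moment_symmetric:
  assumes p: "p > -1" and h: "h > 0" and M: "real M * h = s" and k: "k \<le> M"
  shows "(\<Sum>n = M - k..<M + k. pow_moment s p (real n * h) ((real n + 1) * h)) = 0"
    (is "?S = 0")
proof -
  have "?S = (\<Sum>n = M - k..<M + k. - pow_moment s p (real n * h) ((real n + 1) * h))"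
  \<comment> \<open>Cells are indexed by their left end, and reflection swaps the ends; hence the -
    1.\<close>
  proof (rule sum.reindex_bij_witness[where i = "\<lambda>n. 2 * M - 1 - n" and j = "\<lambda>n. 2 * M - 1 - n"])
    fix n assume n: "n \<in> {M - k..<M + k}"
    then have r: "real (2 * M - 1 - n) = 2 * real M - 1 - real n" using k by auto
    have "pow_moment s p (real (2 * M - 1 - n) * h) ((real (2 * M - 1 - n) + 1) * h)
        = pow_moment s p (2 * s - (real n + 1) * h) (2 * s - real n * h)"
      unfolding r M[symmetric] by (simp add: algebra_simps)
    also have "\<dots> = - pow_moment s p (real n * h) ((real n + 1) * h)"
      using h by (intro pow_moment_reflect p) simp
    finally show "- pow_moment s p (real (2 * M - 1 - n) * h) ((real (2 * M - 1 - n) + 1) * h)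
        = pow_moment s p (real n * h) ((real n + 1) * h)" by simp
  qed (use k in auto)
  also have "\<dots> = - ?S" by (simp add: sum_negf)
  finally show ?thesis by simp
qed

lemma integral_sum_grid:
  fixes f :: "real \<Rightarrow> 'a::banach"
  assumes "f integrable_on {0..real n * h}" "h \<ge> 0"
  shows "(\<Sum>k<n. integral {real k * h..(real k + 1) * h} f) = integral {0..real n * h} f"
  using assms(1)
proof (induction n)
  case (Suc n)
  have "f integrable_on {0..real n * h}"
    using Suc.prems by (rule integrable_on_subinterval)
      (use assms(2) mult_right_mono[of "real n" "1 + real n" h] in auto)
  from Suc.IH[OF this] show ?case
    using Henstock_Kurzweil_Integration.integral_combine[OF _ _ Suc.prems, of "real n * h"] assms(2)
    by (simp add: mult_right_mono add.commute algebra_simps)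
qed simp

section \<open>Splitting the integrand into an end weight and a regular factor\<close>

definition end_weight :: "real \<Rightarrow> real \<Rightarrow> real" where
  "end_weight \<alpha> x = min x (pi - x) powr \<alpha>"

text \<open>The minimum merges the quotients sin x / x of \<open>A1\<close> and sin x / (pi - x) of
  \<open>A2\<close>. \<open>G\<close> stands for the extension of \<open>u_comb\<close> that is
  smooth up to the end points.\<close>

definition reg_factor :: "real \<Rightarrow> real \<Rightarrow> (real \<Rightarrow> complex) \<Rightarrow> real \<Rightarrow> complex" where
  "reg_factor \<alpha> s G x = (sinc (min x (pi - x)) powr \<alpha> * sinc (x - s) powr (1 - \<alpha>)) *\<^sub>R G x"

text \<open>With y = min x (pi - x), y * \<open>sinc y\<close> = sin y = sin x, so the kinks of the
  two factors at pi/2 cancel.\<close>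

lemma end_weight_reg_factor:
  assumes "x \<in> {0..pi}"
  shows "end_weight \<alpha> x *\<^sub>R reg_factor \<alpha> s G x = (sin x powr \<alpha> * sinc (x - s) powr (1 - \<alpha>)) *\<^sub>R G x"
proof -
  define y where "y = min x (pi - x)"
  have y: "0 \<le> y" "y < pi" using assms pi_gt_zero unfolding y_def atLeastAtMost_iff by linarith+
  have "y * sinc y = sin x" by (auto simp: y_def min_def sinc_def)
  then have "y powr \<alpha> * sinc y powr \<alpha> = sin x powr \<alpha>"
    using y sinc_pos[of y] by (simp add: powr_mult[symmetric])
  then show ?thesis
    by (simp add: end_weight_def reg_factor_def y_def[symmetric] mult.assoc[symmetric])
qed

lemma end_weight_left_mono: "\<lbrakk>\<alpha> > 0; 0 \<le> x; x \<le> y; y \<le> pi / 2\<rbrakk> \<Longrightarrow> end_weight \<alpha> x \<le> end_weight \<alpha> y"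
  by (auto simp: end_weight_def min_def intro!: powr_mono2)

lemma end_weight_right_mono: "\<lbrakk>\<alpha> > 0; pi / 2 \<le> x; x \<le> y; y \<le> pi\<rbrakk> \<Longrightarrow> end_weight \<alpha> y \<le> end_weight \<alpha> x"
  by (auto simp: end_weight_def min_def intro!: powr_mono2)

lemma continuous_on_end_weight: "\<alpha> > 0 \<Longrightarrow> A \<subseteq> {0..pi} \<Longrightarrow> continuous_on A (end_weight \<alpha>)"
  unfolding end_weight_def[abs_def] by (intro continuous_on_powr' continuous_intros) auto

lemma C2_end_weight_left:
  assumes "0 < l" "u \<le> pi / 2"
  shows "C2_on_interval l u (\<lambda>x. of_real (end_weight \<alpha> x))"
proof (rule C2_on_interval_cong)
  show "C2_on_interval l u (\<lambda>x. of_real (x powr \<alpha>))"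
    by (rule C2_on_interval_powr[where f = "\<lambda>z. z"]) (use assms in auto)
qed (use assms in \<open>auto simp: end_weight_def min_def\<close>)

lemma C2_end_weight_right:
  assumes "pi / 2 \<le> l" "u < pi"
  shows "C2_on_interval l u (\<lambda>x. of_real (end_weight \<alpha> x))"
proof (rule C2_on_interval_cong)
  show "C2_on_interval l u (\<lambda>x. of_real ((pi - x) powr \<alpha>))"
    by (rule C2_on_interval_powr[where f = "\<lambda>z. of_real pi - z"])
      (use assms in \<open>auto intro!: holomorphic_intros\<close>)
  show "of_real (end_weight \<alpha> x) = complex_of_real ((pi - x) powr \<alpha>)" if "x \<in> {l..u}" for x
  proof -
    have "min x (pi - x) = pi - x" using that assms by auto
    then show ?thesis by (simp add: end_weight_def)
  qed
qed

text \<open>Smoothness reaches up to 0 and pi because the end singularities sit entirely in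
  \<open>end_weight\<close>; within one half the minimum is a single affine function.\<close>

lemma C2_reg_factor:
  assumes s: "0 < s" "s < pi" and G: "C2_on_interval 0 pi G"
    and lu: "0 \<le> l" "u \<le> pi" "u \<le> pi / 2 \<or> pi / 2 \<le> l"
  shows "C2_on_interval l u (reg_factor \<alpha> s G)"
proof -
  have 1: "C2_on_interval l u (\<lambda>x. of_real (sinc (min x (pi - x)) powr \<alpha>))"
    using lu(3)
  proof
    assume u: "u \<le> pi / 2"
    show ?thesis
    proof (rule C2_on_interval_cong)
      show "C2_on_interval l u (\<lambda>x. of_real (sinc (0 + 1 * x) powr \<alpha>))"
        by (rule C2_on_interval_sinc_powr) (use lu u pi_gt_zero in \<open>simp, linarith\<close>)
    qed (use u in \<open>auto simp: min_def\<close>)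
  next
    assume l: "pi / 2 \<le> l"
    show ?thesis
    proof (rule C2_on_interval_cong)
      show "C2_on_interval l u (\<lambda>x. of_real (sinc (pi + (-1) * x) powr \<alpha>))"
        by (rule C2_on_interval_sinc_powr) (use lu l pi_gt_zero in \<open>simp, linarith\<close>)
      show "of_real (sinc (min x (pi - x)) powr \<alpha>) = complex_of_real (sinc (pi + (-1) * x) powr \<alpha>)"
        if "x \<in> {l..u}" for x
      proof -
        have "min x (pi - x) = pi + (-1) * x" using that l by auto
        then show ?thesis by simp
      qed
    qed
  qed
  have 2: "C2_on_interval l u (\<lambda>x. of_real (sinc (- s + 1 * x) powr (1 - \<alpha>)))"
    by (rule C2_on_interval_sinc_powr) (use s lu in auto)
  have "C2_on_interval l u G" using G lu(1,2) by (rule C2_on_interval_subset)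
  from C2_on_interval_mult[OF C2_on_interval_mult[OF 1 2] this]
  show ?thesis
    by (rule C2_on_interval_cong) (simp add: reg_factor_def scaleR_conv_of_real)
qed

lemma C2_sin_powr_sinc_powr:
  assumes s: "0 < s" "s < pi" and G: "C2_on_interval 0 pi G" and lu: "0 < l" "u < pi"
  shows "C2_on_interval l u (\<lambda>x. (sin x powr \<alpha> * sinc (x - s) powr (1 - \<alpha>)) *\<^sub>R G x)"
proof -
  have 1: "C2_on_interval l u (\<lambda>x. of_real (sin x powr \<alpha>))"
    by (rule C2_on_interval_powr[where f = sin])
      (use lu in \<open>auto intro!: holomorphic_intros sin_gt_zero simp: sin_of_real\<close>)
  have 2: "C2_on_interval l u (\<lambda>x. of_real (sinc (- s + 1 * x) powr (1 - \<alpha>)))"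
    by (rule C2_on_interval_sinc_powr) (use s lu in auto)
  have "C2_on_interval l u G" by (rule C2_on_interval_subset[OF G]) (use lu in auto)
  from C2_on_interval_mult[OF C2_on_interval_mult[OF 1 2] this]
  show ?thesis
    by (rule C2_on_interval_cong) (simp add: scaleR_conv_of_real)
qed

text \<open>The constant is chosen before the grid. The margin 2 d keeps the window of half-width
  \<open>d\<close> at distance at least \<open>d\<close> from 0 and pi. The window actually used has
  half-width k h, so that it is a union of cells symmetric about \<open>s\<close>.\<close>

lemma sum_cell_error_bound:
  assumes \<alpha>: "0 < \<alpha>" "\<alpha> < 2" and d: "0 < d" "2 * d \<le> s" "s \<le> pi - 2 * d"
    and G: "C2_on_interval 0 pi G"
  obtains C where "\<And>h M k R. \<lbrakk>h > 0; real M * h = s; 2 * real R * h = pi;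
      d / 2 \<le> real k * h; real k * h \<le> d\<rbrakk> \<Longrightarrow>
    norm (\<Sum>n<2 * R. cell_error s (1 - \<alpha>) (end_weight \<alpha>) (reg_factor \<alpha> s G) (real n * h) ((real n + 1) * h))
      \<le> C * h\<^sup>2"
proof -
  define p where "p = 1 - \<alpha>"
  define \<phi> where "\<phi> = end_weight \<alpha>"
  define g where "g = reg_factor \<alpha> s G"
  define F where "F x = (sin x powr \<alpha> * sinc (x - s) powr p) *\<^sub>R G x" for x
  have p: "p > -1" using \<alpha> by (simp add: p_def)
  have s: "0 < s" "s < pi" using d by auto
  have F: "F x = \<phi> x *\<^sub>R g x" if "x \<in> {0..pi}" for x
    using end_weight_reg_factor[OF that, of \<alpha> s G] by (simp add: F_def \<phi>_def g_def p_def)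
  have "C2_on_interval (s - d) (s + d) F"
    unfolding F_def[abs_def] p_def by (rule C2_sin_powr_sinc_powr[OF s G]) (use d in auto)
  then obtain F' BF where BF: "BF \<ge> 0"
    "\<And>x y. x \<in> {s-d..s+d} \<Longrightarrow> y \<in> {s-d..s+d} \<Longrightarrow> norm (F' x - F' y) \<le> BF * \<bar>x - y\<bar>"
    "\<And>x y. x \<in> {s-d..s+d} \<Longrightarrow> y \<in> {s-d..s+d} \<Longrightarrow>
        norm (F x - F y - (x - y) *\<^sub>R F' y) \<le> BF * (x - y)\<^sup>2"
    by (rule C2_on_interval_bounds) blast
  define half where "half l u \<longleftrightarrow> (l = 0 \<and> u = pi / 2) \<or> (l = pi / 2 \<and> u = pi)" for l u :: real
  \<comment> \<open>The far estimate starts at distance d / 2 and the near one reaches to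
    \<open>d\<close>. The overlap leaves room for k h anywhere between, so each cell falls under one
    of them.\<close>
  define bnd where "bnd C l u \<longleftrightarrow> (\<forall>a b. l \<le> a \<and> a < b \<and> b \<le> u \<longrightarrow>
      (b \<le> s - d / 2 \<or> s + d / 2 \<le> a \<longrightarrow>
        norm (cell_error s p \<phi> g a b) \<le> C * (b - a)\<^sup>2 * (\<bar>\<phi> b - \<phi> a\<bar> + (b - a))) \<and>
      (s - d \<le> a \<and> b \<le> s + d \<longrightarrow>
        norm (cell_error s p \<phi> g a b - pow_moment s p a b *\<^sub>R F' s)
          \<le> C * (b - a)\<^sup>2 * pow_mass s p a b))" for C l u
  have ex: "\<exists>C\<ge>0. bnd C l u" if lu: "half l u" for l u
  proof -
    have lu': "0 \<le> l" "u \<le> pi" "u \<le> pi / 2 \<or> pi / 2 \<le> l"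
      using lu pi_gt_zero unfolding half_def by linarith+
    have cont: "continuous_on {l..u} \<phi>"
      unfolding \<phi>_def using \<alpha> lu' by (intro continuous_on_end_weight) auto
    have g: "C2_on_interval l u g"
      unfolding g_def by (rule C2_reg_factor[OF s G lu'])
    have \<phi>: "C2_on_interval (max l (s - d)) (min u (s + d)) (\<lambda>x. of_real (\<phi> x))"
      using lu'(3)
    proof
      assume "u \<le> pi / 2"
      then show ?thesis unfolding \<phi>_def by (intro C2_end_weight_left) (use d in linarith)+
    next
      assume "pi / 2 \<le> l"
      then show ?thesis unfolding \<phi>_def by (intro C2_end_weight_right) (use d in linarith)+
    qed
    have mono: "\<bar>\<phi> x - \<phi> y\<bar> \<le> \<bar>\<phi> b - \<phi> a\<bar>"
      if "l \<le> a" "b \<le> u" "x \<in> {a..b}" "y \<in> {a..b}" for a b x y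
      using lu'(3)
    proof
      assume "u \<le> pi / 2"
      then have "\<phi> a \<le> \<phi> x" "\<phi> x \<le> \<phi> b" "\<phi> a \<le> \<phi> y" "\<phi> y \<le> \<phi> b"
        using that lu' \<alpha> by (auto simp: \<phi>_def intro!: end_weight_left_mono)
      then show ?thesis by linarith
    next
      assume "pi / 2 \<le> l"
      then have "\<phi> b \<le> \<phi> x" "\<phi> x \<le> \<phi> a" "\<phi> b \<le> \<phi> y" "\<phi> y \<le> \<phi> a"
        using that lu' \<alpha> by (auto simp: \<phi>_def intro!: end_weight_right_mono)
      then show ?thesis by linarith
    qed
    have d2: "d / 2 > 0" using d by simp
    obtain C1 where C1: "C1 \<ge> 0" "\<And>a b. \<lbrakk>l \<le> a; a < b; b \<le> u; b \<le> s - d / 2 \<or> s + d / 2 \<le> a\<rbrakk> \<Longrightarrow>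
      norm (cell_error s p \<phi> g a b) \<le> C1 * (b - a)\<^sup>2 * (\<bar>\<phi> b - \<phi> a\<bar> + (b - a))"
      using cell_error_far[OF d2 cont g mono] by blast
    have FF: "\<And>x. x \<in> {l..u} \<Longrightarrow> F x = \<phi> x *\<^sub>R g x" using F lu' by auto
    obtain C2 where C2: "C2 \<ge> 0" "\<And>a b. \<lbrakk>l \<le> a; a < b; b \<le> u; s - d \<le> a; b \<le> s + d\<rbrakk> \<Longrightarrow>
      norm (cell_error s p \<phi> g a b - pow_moment s p a b *\<^sub>R F' s)
        \<le> C2 * (b - a)\<^sup>2 * pow_mass s p a b"
      using cell_error_near[OF p d(1) cont g \<phi> BF(1) FF BF(2,3)] by blast
    have up1: "C1 * (b - a)\<^sup>2 * v \<le> (C1 + C2) * (b - a)\<^sup>2 * v" if "0 \<le> v" for v a b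
      using that C2(1) by (auto intro!: mult_right_mono)
    have up2: "C2 * (b - a)\<^sup>2 * v \<le> (C1 + C2) * (b - a)\<^sup>2 * v" if "0 \<le> v" for v a b
      using that C1(1) by (auto intro!: mult_right_mono)
    have "bnd (C1 + C2) l u"
      unfolding bnd_def
    proof (intro allI impI conjI, goal_cases)
      case (1 a b)
      then show ?case by (intro order_trans[OF C1(2) up1]) auto
    next
      case (2 a b)
      then show ?case by (intro order_trans[OF C2(2) up2] pow_mass_nonneg[OF p]) auto
    qed
    then show ?thesis using C1(1) C2(1) by (intro exI[of _ "C1 + C2"]) auto
  qed
  obtain C1 where C1: "C1 \<ge> 0" "bnd C1 0 (pi / 2)" using ex[of 0 "pi / 2"] by (auto simp: half_def)
  obtain C2 where C2: "C2 \<ge> 0" "bnd C2 (pi / 2) pi" using ex[of "pi / 2" pi] by (auto simp: half_def)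
  define C where "C = C1 + C2"
  have C: "C \<ge> 0" "C1 \<le> C" "C2 \<le> C" using C1 C2 by (auto simp: C_def)
  \<comment> \<open>Total variation of \<open>\<phi>\<close>, total length of the cells, total mass
    of the singular weight.\<close>
  define K where "K = C * (2 * \<phi> (pi / 2) + pi + pow_mass s p 0 pi)"
  show ?thesis
  proof (rule that[of K])
    fix h :: real and M k R :: nat
    assume h: "h > 0" and M: "real M * h = s" and R: "2 * real R * h = pi"
      and k: "d / 2 \<le> real k * h" "real k * h \<le> d"
    define a where "a n = real n * h" for n
    have ab: "a (Suc n) = (real n + 1) * h" "a n < a (Suc n)" "a (Suc n) - a n = h" for n
      using h by (simp_all add: a_def algebra_simps)
    have a_le: "a m \<le> a n" if "m \<le> n" for m n using that h by (simp add: a_def)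
    have aR: "a R = pi / 2" "a (2 * R) = pi" "a 0 = 0" using R by (simp_all add: a_def)
    define e where "e n = cell_error s p \<phi> g (a n) (a (Suc n))" for n
    define D where "D n = pow_moment s p (a n) (a (Suc n))" for n
    define P where "P n = pow_mass s p (a n) (a (Suc n))" for n
    define w where "w n = \<bar>\<phi> (a (Suc n)) - \<phi> (a n)\<bar>" for n
    define near where "near = {M - k..<M + k}"
    have kM: "k \<le> M"
    proof -
      have "real k * h \<le> real M * h" using k M d by linarith
      then show ?thesis using h by simp
    qed
    have MkR: "M + k \<le> 2 * R"
    proof -
      have "real (M + k) * h \<le> real (2 * R) * h" using k M R d by (simp add: algebra_simps)
      then show ?thesis using h by (simp only: mult_le_cancel_right of_nat_le_iff)
    qed
    have aMk: "a (M - k) = s - real k * h" "a (M + k) = s + real k * h"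
      using M kM by (simp_all add: a_def of_nat_diff algebra_simps)
    have P0: "P n \<ge> 0" for n unfolding P_def using ab(2) by (intro pow_mass_nonneg p) (simp add: less_imp_le)
    have loc: "norm (e n - (if n \<in> near then D n else 0) *\<^sub>R F' s) \<le> C * h\<^sup>2 * (w n + h + P n)"
      if n: "n < 2 * R" for n
    proof -
      \<comment> \<open>pi / 2 is the grid point with index \<open>R\<close>, so no cell straddles
        it.\<close>
      obtain l u C' where lu: "bnd C' l u" "l \<le> a n" "a (Suc n) \<le> u" "0 \<le> C'" "C' \<le> C"
      proof (cases "n < R")
        case True
        show ?thesis by (rule that[OF C1(2)]) (use a_le[of "Suc n" R] a_le[of 0 n] True aR C C1 in auto)
      next
        case False
        show ?thesis by (rule that[OF C2(2)]) (use a_le[of R n] a_le[of "Suc n" "2 * R"] n False aR C C2 in auto)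
      qed
      have w0: "w n \<ge> 0" by (simp add: w_def)
      have up: "t \<le> C' * h\<^sup>2 * v \<Longrightarrow> 0 \<le> v \<Longrightarrow> v \<le> w n + h + P n \<Longrightarrow> t \<le> C * h\<^sup>2 * (w n + h + P n)" for t v
        using lu(4,5) C(1) by (elim order_trans) (intro mult_mono mult_right_mono; simp)
      show ?thesis
      proof (cases "n \<in> near")
        case True
        have "s - d \<le> a n" using a_le[of "M - k" n] aMk k True by (auto simp: near_def)
        moreover have "a (Suc n) \<le> s + d" using a_le[of "Suc n" "M + k"] aMk k True by (auto simp: near_def)
        ultimately have "norm (e n - D n *\<^sub>R F' s) \<le> C' * h\<^sup>2 * P n"
          using lu ab(2)[of n] unfolding bnd_def e_def D_def P_def by (metis ab(3))
        then have "norm (e n - D n *\<^sub>R F' s) \<le> C * h\<^sup>2 * (w n + h + P n)"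
          using w0 h P0[of n] by (elim up) auto
        then show ?thesis using True by simp
      next
        case False
        have "a (Suc n) \<le> s - d / 2 \<or> s + d / 2 \<le> a n"
          using a_le[of "Suc n" "M - k"] a_le[of "M + k" n] aMk k False by (auto simp: near_def)
        then have "norm (e n) \<le> C' * h\<^sup>2 * (w n + h)"
          using lu ab(2)[of n] unfolding bnd_def e_def w_def by (metis ab(3))
        then have "norm (e n) \<le> C * h\<^sup>2 * (w n + h + P n)"
          using w0 h P0[of n] by (elim up) auto
        then show ?thesis using False by simp
      qed
    qed
    have D0: "(\<Sum>n<2 * R. if n \<in> near then D n else 0) = 0"
    proof -
      have "(\<Sum>n<2 * R. if n \<in> near then D n else 0) = (\<Sum>n\<in>near. D n)"
        using MkR by (intro sum.mono_neutral_cong_right) (auto simp: near_def)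
      also have "\<dots> = 0"
        unfolding near_def D_def ab(1) unfolding a_def
        by (rule sum_pow_moment_symmetric[OF p h M kM])
      finally show ?thesis .
    qed
    have W: "(\<Sum>n<2 * R. w n) \<le> 2 * \<phi> (pi / 2)"
    proof -
      have split: "{..<2 * R} = {..<R} \<union> {R..<2 * R}" by auto
      have "(\<Sum>n<2 * R. w n) = (\<Sum>n<R. w n) + (\<Sum>n = R..<2 * R. w n)"
        unfolding split by (rule sum.union_disjoint) auto
      also have "(\<Sum>n<R. w n) = (\<Sum>n<R. \<phi> (a (Suc n)) - \<phi> (a n))"
      proof (rule sum.cong)
        fix n assume n: "n \<in> {..<R}"
        have "\<phi> (a n) \<le> \<phi> (a (Suc n))" unfolding \<phi>_def
          using n a_le[of "Suc n" R] a_le[of 0 n] aR ab(2)[of n] \<alpha>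
          by (intro end_weight_left_mono) auto
        then show "w n = \<phi> (a (Suc n)) - \<phi> (a n)" by (simp add: w_def)
      qed simp
      also have "\<dots> = \<phi> (pi / 2) - \<phi> 0" using sum_lessThan_telescope[of "\<lambda>n. \<phi> (a n)" R] aR by simp
      also have "(\<Sum>n = R..<2 * R. w n) = (\<Sum>n = R..<2 * R. - (\<phi> (a (Suc n)) - \<phi> (a n)))"
      proof (rule sum.cong)
        fix n assume n: "n \<in> {R..<2 * R}"
        have "\<phi> (a (Suc n)) \<le> \<phi> (a n)" unfolding \<phi>_def
          using n a_le[of R n] a_le[of "Suc n" "2 * R"] aR ab(2)[of n] \<alpha>
          by (intro end_weight_right_mono) auto
        then show "w n = - (\<phi> (a (Suc n)) - \<phi> (a n))" by (simp add: w_def)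
      qed simp
      also have "\<dots> = \<phi> (pi / 2) - \<phi> pi"
        unfolding sum_negf by (subst sum_Suc_diff') (simp_all add: aR)
      finally show ?thesis by (simp add: \<phi>_def end_weight_def)
    qed
    have PP: "(\<Sum>n<2 * R. P n) = pow_mass s p 0 pi"
    proof -
      have "(\<lambda>x. \<bar>x - s\<bar> powr p) integrable_on {0..pi}"
        using has_integral_abs_powr[OF p, of 0 pi s] pi_ge_zero by blast
      then show ?thesis
        using integral_sum_grid[of "\<lambda>x. \<bar>x - s\<bar> powr p" "2 * R" h] R h
        unfolding P_def pow_mass_def ab(1) unfolding a_def by simp
    qed
    \<comment> \<open>The moment terms add up to zero and may be inserted before taking norms cell
      by cell.\<close>
    have "norm (\<Sum>n<2 * R. e n) = norm (\<Sum>n<2 * R. e n - (if n \<in> near then D n else 0) *\<^sub>R F' s)"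
      using D0 by (simp add: sum_subtractf scaleR_sum_left[symmetric])
    also have "\<dots> \<le> (\<Sum>n<2 * R. C * h\<^sup>2 * (w n + h + P n))"
      by (rule sum_norm_le) (use loc in auto)
    also have "\<dots> = C * h\<^sup>2 * ((\<Sum>n<2 * R. w n) + pi + pow_mass s p 0 pi)"
      using R PP by (simp add: sum_distrib_left[symmetric] sum.distrib)
    also have "\<dots> \<le> C * h\<^sup>2 * (2 * \<phi> (pi / 2) + pi + pow_mass s p 0 pi)"
      using W C by (intro mult_left_mono) auto
    finally show "norm (\<Sum>n<2 * R. cell_error s (1 - \<alpha>) (end_weight \<alpha>) (reg_factor \<alpha> s G)
        (real n * h) ((real n + 1) * h)) \<le> K * h\<^sup>2"
      unfolding e_def ab(1) K_def unfolding a_def p_def \<phi>_def g_def by (simp add: mult_ac)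
  qed
qed

section \<open>The fractional Laplacian\<close>

lemma integral_powr_left:
  fixes \<alpha> a b :: real
  assumes "\<alpha> > -1" "0 \<le> a" "a \<le> b"
  shows "integral {a..b} (\<lambda>x. x powr \<alpha>) = (b powr (\<alpha> + 1) - a powr (\<alpha> + 1)) / (\<alpha> + 1)"
proof -
  have "integral {a..b} (\<lambda>x. x powr \<alpha>) = pow_mass 0 \<alpha> a b"
    unfolding pow_mass_def using assms by (intro integral_cong) auto
  then show ?thesis
    using assms by (cases "a = 0"; cases "b = 0") (auto simp: pow_mass_eq signed_powr_def)
qed

lemma integral_powr_right:
  fixes \<alpha> a b c :: real
  assumes "\<alpha> > -1" "a \<le> b" "b \<le> c"
  shows "integral {a..b} (\<lambda>x. (c - x) powr \<alpha>)
    = ((c - a) powr (\<alpha> + 1) - (c - b) powr (\<alpha> + 1)) / (\<alpha> + 1)"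
proof -
  have "integral {a..b} (\<lambda>x. (c - x) powr \<alpha>) = pow_mass c \<alpha> a b"
    unfolding pow_mass_def using assms by (intro integral_cong) auto
  then show ?thesis
    using assms by (cases "a = c"; cases "b = c") (auto simp: pow_mass_eq signed_powr_def)
qed

lemma continuous_on_sin_powr_sinc_powr:
  assumes "\<alpha> > 0" "0 < s" "s < pi" "continuous_on {0..pi} G"
  shows "continuous_on {0..pi} (\<lambda>x. (sin x powr \<alpha> * sinc (x - s) powr p) *\<^sub>R (G x :: complex))"
proof -
  have "C2_on_interval 0 pi (\<lambda>x. of_real (sinc (- s + 1 * x) powr p))"
    by (rule C2_on_interval_sinc_powr) (use assms in auto)
  then have c: "continuous_on {0..pi} (\<lambda>x. complex_of_real (sinc (x - s) powr p))"
    using C2_on_interval_continuous by fastforce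
  have "continuous_on {0..pi} (\<lambda>x. sin x powr \<alpha>)"
    using assms by (intro continuous_on_powr' continuous_intros) (auto intro: sin_ge_zero)
  then have "continuous_on {0..pi} (\<lambda>x. sin x powr \<alpha> *\<^sub>R (of_real (sinc (x - s) powr p) * G x))"
    using c assms(4) by (intro continuous_on_scaleR continuous_on_mult)
  then show ?thesis by (simp add: scaleR_conv_of_real mult.assoc)
qed

text \<open>The kernel |sin(s - x)|^(1 - \<alpha>) splits into |x - s|^(1 - \<alpha>), whose mass is
  known exactly, and a power of \<open>sinc\<close>, which is smooth since |x - s| < pi.\<close>

lemma frac_laplacian_eq:
  assumes s: "0 < s" "s < pi" and G: "\<And>x. x \<in> {0<..<pi} \<Longrightarrow> G x = u_comb L u x"
  shows "frac_laplacian L \<alpha> u s = prefactor L \<alpha> s *\<^sub>R integral {0..pi}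
    (\<lambda>x. (\<bar>x - s\<bar> powr (1 - \<alpha>) * end_weight \<alpha> x) *\<^sub>R reg_factor \<alpha> s G x)"
proof -
  have "integral {0..pi} (\<lambda>x. (sin x powr \<alpha> / \<bar>sin (s - x)\<bar> powr (\<alpha> - 1)) *\<^sub>R u_comb L u x)
      = integral {0..pi} (\<lambda>x. (\<bar>x - s\<bar> powr (1 - \<alpha>) * end_weight \<alpha> x) *\<^sub>R reg_factor \<alpha> s G x)"
  \<comment> \<open>At 0 and pi the function \<open>G\<close> need not agree with
    \<open>u_comb\<close>, whose values there are arbitrary; at \<open>s\<close> the kernel
    degenerates.\<close>
  proof (rule integral_spike[of "{0, s, pi}"])
    fix x assume x: "x \<in> {0..pi} - {0, s, pi}"
    then have sc: "sinc (x - s) > 0" using s by (intro sinc_pos) auto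
    have "sinc (x - s) = sinc (s - x)" using sinc_minus[of "s - x"] by simp
    moreover have "sin (s - x) = (s - x) * sinc (s - x)" by (simp add: sinc_def)
    ultimately have "\<bar>sin (s - x)\<bar> = \<bar>x - s\<bar> * \<bar>sinc (x - s)\<bar>"
      by (simp add: abs_mult abs_minus_commute)
    then have "\<bar>sin (s - x)\<bar> powr (1 - \<alpha>) = \<bar>x - s\<bar> powr (1 - \<alpha>) * sinc (x - s) powr (1 - \<alpha>)"
      using sc by (simp add: powr_mult)
    moreover have "sin x powr \<alpha> / \<bar>sin (s - x)\<bar> powr (\<alpha> - 1) = sin x powr \<alpha> * \<bar>sin (s - x)\<bar> powr (1 - \<alpha>)"
      using powr_minus_divide[of "\<bar>sin (s - x)\<bar>" "\<alpha> - 1"] by simp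
    moreover have "(\<bar>x - s\<bar> powr (1 - \<alpha>) * end_weight \<alpha> x) *\<^sub>R reg_factor \<alpha> s G x
        = \<bar>x - s\<bar> powr (1 - \<alpha>) *\<^sub>R ((sin x powr \<alpha> * sinc (x - s) powr (1 - \<alpha>)) *\<^sub>R u_comb L u x)"
      using end_weight_reg_factor[of x \<alpha> s G] x G[of x] by (simp flip: scaleR_scaleR)
    ultimately show "(\<bar>x - s\<bar> powr (1 - \<alpha>) * end_weight \<alpha> x) *\<^sub>R reg_factor \<alpha> s G x
        = (sin x powr \<alpha> / \<bar>sin (s - x)\<bar> powr (\<alpha> - 1)) *\<^sub>R u_comb L u x"
      by (simp add: mult_ac)
  qed auto
  then show ?thesis by (simp add: frac_laplacian_def)
qed

text \<open>This puts every node on every grid, which the reflection argument relies on. For N = 0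
  both sides vanish by division by zero.\<close>

lemma node_eq_grid: "r \<ge> 1 \<Longrightarrow> node N j = real (r * (2 * j + 1)) * step N r"
  by (cases "N = 0") (simp_all add: node_def step_def field_simps)

text \<open>An exact identity: the differences of powers in \<open>A1\<close> and \<open>A2\<close>
  are the masses of \<open>end_weight\<close> and of |x - s|^(1 - \<alpha>) on a cell, and the
  sampled quotients together with \<open>u_comb\<close> make up \<open>reg_factor\<close> at the
  midpoint.\<close>

lemma error_eq_sum_cell_error:
  assumes \<alpha>: "0 < \<alpha>" "\<alpha> < 2" and N: "N \<ge> 1" and r: "r \<ge> 1"
    and s: "0 < node N j" "node N j < pi"
    and C2: "C2_on_interval 0 pi G" and G: "\<And>x. x \<in> {0<..<pi} \<Longrightarrow> G x = u_comb L u x"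
  shows "frac_laplacian L \<alpha> u (node N j) - A1 L \<alpha> u N r j - A2 L \<alpha> u N r j
    = prefactor L \<alpha> (node N j) *\<^sub>R (\<Sum>n<2 * (r * N).
        cell_error (node N j) (1 - \<alpha>) (end_weight \<alpha>) (reg_factor \<alpha> (node N j) G)
          (real n * step N r) ((real n + 1) * step N r))"
proof -
  define s where "s = node N j"
  define h where "h = step N r"
  define R where "R = r * N"
  define p where "p = 1 - \<alpha>"
  define g where "g = reg_factor \<alpha> s G"
  define \<phi> where "\<phi> = end_weight \<alpha>"
  define a b m where "a n = real n * h" and "b n = (real n + 1) * h" and "m n = (a n + b n) / 2" for n
  define Q where "Q n = (integral {a n..b n} \<phi> * pow_mass s p (a n) (b n) / h) *\<^sub>R g (m n)" for n
  have sp: "0 < s" "s < pi" using s by (simp_all add: s_def)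
  have p: "p > -1" using \<alpha> by (simp add: p_def)
  have h: "h > 0" using N r by (simp add: h_def step_def)
  have R: "2 * real R * h = pi" using N r by (simp add: h_def R_def step_def)
  have M: "s = real (r * (2 * j + 1)) * h" unfolding s_def h_def by (rule node_eq_grid[OF r])
  have grid: "grid N r (real n) = a n" "grid N r (real n + 1) = b n" "grid N r (real n + 1/2) = m n" for n
    by (simp_all add: grid_def a_def b_def m_def h_def field_simps)
  \<comment> \<open>By parity: \<open>s\<close> is an even multiple of h / 2, a midpoint an odd one.
    Hence \<open>sinc (m n - s)\<close> is the plain quotient of the rule.\<close>
  have ms: "m n \<noteq> s" for n
  proof
    assume "m n = s"
    then have "(real n + 1/2) * h = real (r * (2 * j + 1)) * h"
      unfolding M[symmetric] by (simp add: m_def a_def b_def field_simps)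
    then have "real n + 1/2 = real (r * (2 * j + 1))" using h by (simp only: mult_cancel_right) auto
    then have "real (2 * n + 1) = real (2 * (r * (2 * j + 1)))" by simp
    then have "2 * n + 1 = 2 * (r * (2 * j + 1))" by (simp only: of_nat_eq_iff)
    then show False by presburger
  qed
  have ab: "0 \<le> a n" "a n < b n" "b n - a n = h" for n
    using h by (simp_all add: a_def b_def algebra_simps)
  have m: "a n < m n" "m n < b n" for n using ab(2)[of n] by (simp_all add: m_def)
  have bup: "b n \<le> real k * h" if "n < k" for n k
    using that h unfolding b_def by (intro mult_right_mono) auto
  have aup: "real k * h \<le> a n" if "k \<le> n" for n k
    using that h unfolding a_def by (intro mult_right_mono) auto
  have Rh: "real R * h = pi / 2" "real (2 * R) * h = pi" using R by simp_all
  have mass: "pow_mass s p (a n) (b n)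
      = (signed_powr (b n - s) (2 - \<alpha>) - signed_powr (a n - s) (2 - \<alpha>)) / (2 - \<alpha>)" for n
    using pow_mass_eq[OF p, of "a n" "b n" s] ab(2)[of n] by (simp add: p_def)
  have u: "u_comb L u (m n) = G (m n)" if "n < 2 * R" for n
    using G[of "m n"] m[of n] ab(1)[of n] bup[OF that] Rh by auto
  have left: "Q n = (1 / h * ((sin (m n) / m n) powr \<alpha> * (sin (m n - s) / (m n - s)) powr (1 - \<alpha>)
       * ((b n powr (\<alpha> + 1) - a n powr (\<alpha> + 1)) / (\<alpha> + 1))
       * ((signed_powr (b n - s) (2 - \<alpha>) - signed_powr (a n - s) (2 - \<alpha>)) / (2 - \<alpha>)))) *\<^sub>R u_comb L u (m n)"
    if n: "n < R" for n
  proof -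
    have bn: "b n \<le> pi / 2" using bup[OF n] Rh by simp
    have "integral {a n..b n} \<phi> = integral {a n..b n} (\<lambda>x. x powr \<alpha>)"
      using bn by (intro integral_cong) (auto simp: \<phi>_def end_weight_def min_def)
    also have "\<dots> = (b n powr (\<alpha> + 1) - a n powr (\<alpha> + 1)) / (\<alpha> + 1)"
      using \<alpha> ab[of n] by (intro integral_powr_left) auto
    finally have i: "integral {a n..b n} \<phi> = (b n powr (\<alpha> + 1) - a n powr (\<alpha> + 1)) / (\<alpha> + 1)" .
    have "min (m n) (pi - m n) = m n" using m[of n] bn by auto
    moreover have "m n \<noteq> 0" using m[of n] ab(1)[of n] by linarith
    ultimately have "g (m n) = ((sin (m n) / m n) powr \<alpha> * (sin (m n - s) / (m n - s)) powr (1 - \<alpha>)) *\<^sub>R G (m n)"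
      using ms[of n] by (simp add: g_def reg_factor_def sinc_def)
    then show ?thesis unfolding Q_def i mass using u[of n] n by (simp add: mult_ac)
  qed
  have right: "Q n = (1 / h * ((sin (m n) / (pi - m n)) powr \<alpha> * (sin (m n - s) / (m n - s)) powr (1 - \<alpha>)
       * (((pi - a n) powr (\<alpha> + 1) - (pi - b n) powr (\<alpha> + 1)) / (\<alpha> + 1))
       * ((signed_powr (b n - s) (2 - \<alpha>) - signed_powr (a n - s) (2 - \<alpha>)) / (2 - \<alpha>)))) *\<^sub>R u_comb L u (m n)"
    if n: "R \<le> n" "n < 2 * R" for n
  proof -
    have an: "pi / 2 \<le> a n" and bn: "b n \<le> pi" using aup[OF n(1)] bup[OF n(2)] Rh by simp_all
    have mn: "min x (pi - x) = pi - x" if "x \<ge> pi / 2" for x using that by auto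
    have "integral {a n..b n} \<phi> = integral {a n..b n} (\<lambda>x. (pi - x) powr \<alpha>)"
      using an by (intro integral_cong) (simp add: \<phi>_def end_weight_def mn)
    also have "\<dots> = ((pi - a n) powr (\<alpha> + 1) - (pi - b n) powr (\<alpha> + 1)) / (\<alpha> + 1)"
      using \<alpha> ab[of n] bn by (intro integral_powr_right) auto
    finally have i: "integral {a n..b n} \<phi>
        = ((pi - a n) powr (\<alpha> + 1) - (pi - b n) powr (\<alpha> + 1)) / (\<alpha> + 1)" .
    have "min (m n) (pi - m n) = pi - m n" using m[of n] an by (intro mn) auto
    moreover have "pi - m n \<noteq> 0" using m[of n] bn by linarith
    ultimately have "g (m n) = ((sin (m n) / (pi - m n)) powr \<alpha> * (sin (m n - s) / (m n - s)) powr (1 - \<alpha>)) *\<^sub>R G (m n)"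
      using ms[of n] by (simp add: g_def reg_factor_def sinc_def)
    then show ?thesis unfolding Q_def i mass using u[of n] n by (simp add: mult_ac)
  qed
  have A1: "A1 L \<alpha> u N r j = prefactor L \<alpha> s *\<^sub>R (\<Sum>n = 0..<R. Q n)"
  proof -
    have "A1 L \<alpha> u N r j = prefactor L \<alpha> s *\<^sub>R ((1 / h) *\<^sub>R (\<Sum>n = 0..<R. h *\<^sub>R Q n))"
      unfolding A1_def Let_def grid s_def[symmetric] h_def[symmetric] R_def[symmetric]
      using h by (simp add: left)
    then show ?thesis using h by (simp add: scaleR_sum_right[symmetric])
  qed
  have A2: "A2 L \<alpha> u N r j = prefactor L \<alpha> s *\<^sub>R (\<Sum>n = R..<2 * R. Q n)"
  proof -
    have R2: "2 * r * N = 2 * R" by (simp add: R_def)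
    have "A2 L \<alpha> u N r j = prefactor L \<alpha> s *\<^sub>R ((1 / h) *\<^sub>R (\<Sum>n = R..<2 * R. h *\<^sub>R Q n))"
      unfolding A2_def Let_def grid s_def[symmetric] h_def[symmetric] R_def[symmetric] R2
      using h by (simp add: right)
    then show ?thesis using h by (simp add: scaleR_sum_right[symmetric])
  qed
  have AA: "A1 L \<alpha> u N r j + A2 L \<alpha> u N r j = prefactor L \<alpha> s *\<^sub>R (\<Sum>n<2 * R. Q n)"
    unfolding A1 A2 scaleR_add_right[symmetric] lessThan_atLeast0
    by (subst sum.atLeastLessThan_concat) auto
  define W where "W x = (\<bar>x - s\<bar> powr p * \<phi> x) *\<^sub>R g x" for x
  have "W integrable_on {0..pi}"
  proof (rule integrable_eq)
    show "(\<lambda>x. \<bar>x - s\<bar> powr p *\<^sub>R ((sin x powr \<alpha> * sinc (x - s) powr p) *\<^sub>R G x)) integrable_on {0..pi}"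
      using has_integral_abs_powr[OF p, of 0 pi s] \<alpha> sp C2_on_interval_continuous[OF C2]
      by (intro integrable_nonneg_scaleR_continuous continuous_on_sin_powr_sinc_powr) auto
    show "\<bar>x - s\<bar> powr p *\<^sub>R ((sin x powr \<alpha> * sinc (x - s) powr p) *\<^sub>R G x) = W x"
      if "x \<in> {0..pi}" for x
      unfolding W_def \<phi>_def g_def p_def scaleR_scaleR[symmetric] end_weight_reg_factor[OF that] by simp
  qed
  then have "W integrable_on {0..real (2 * R) * h}" unfolding Rh .
  from integral_sum_grid[OF this] have W: "(\<Sum>n<2 * R. integral {a n..b n} W) = integral {0..pi} W"
    unfolding Rh a_def b_def using h by simp
  have FL: "frac_laplacian L \<alpha> u s = prefactor L \<alpha> s *\<^sub>R integral {0..pi} W"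
    unfolding W_def[abs_def] p_def \<phi>_def g_def by (rule frac_laplacian_eq[OF sp G])
  have "frac_laplacian L \<alpha> u s - A1 L \<alpha> u N r j - A2 L \<alpha> u N r j
      = frac_laplacian L \<alpha> u s - (A1 L \<alpha> u N r j + A2 L \<alpha> u N r j)"
    by (rule diff_diff_add)
  also have "\<dots> = prefactor L \<alpha> s *\<^sub>R (\<Sum>n<2 * R. integral {a n..b n} W - Q n)"
    unfolding AA FL sum_subtractf W by (rule scaleR_diff_right[symmetric])
  also have "(\<Sum>n<2 * R. integral {a n..b n} W - Q n) = (\<Sum>n<2 * R. cell_error s p \<phi> g (a n) (b n))"
    unfolding cell_error_def Q_def W_def m_def ab(3) ..
  finally show ?thesis
    unfolding a_def b_def g_def \<phi>_def p_def R_def h_def s_def .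
qed

theorem corollary2:
  fixes L \<alpha> :: real and u :: "real \<Rightarrow> complex" and N :: nat
  assumes "L > 0"
    and "\<forall>s\<in>{0<..<pi}. u_cot L u differentiable (at s)"
    and "\<forall>s\<in>{0<..<pi}. u_s L u differentiable (at s)"
    and "\<exists>G. C2_on_interval 0 pi G \<and> (\<forall>s\<in>{0<..<pi}. G s = u_comb L u s)"
    and "\<alpha> \<in> {0<..<1} \<union> {1<..<2}"
    and "N \<ge> 1"
  shows "\<exists>K>0. \<forall>r\<ge>1. \<forall>j<N.
           norm (frac_laplacian L \<alpha> u (node N j) - A1 L \<alpha> u N r j - A2 L \<alpha> u N r j)
             \<le> K / (real r)\<^sup>2"
proof -
  define E where
    "E r j = norm (frac_laplacian L \<alpha> u (node N j) - A1 L \<alpha> u N r j - A2 L \<alpha> u N r j)" for r j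
  obtain G where C2: "C2_on_interval 0 pi G" and G: "\<And>x. x \<in> {0<..<pi} \<Longrightarrow> G x = u_comb L u x"
    using assms(4) by blast
  have \<alpha>: "0 < \<alpha>" "\<alpha> < 2" using assms(5) by auto
  have "\<exists>K\<ge>0. \<forall>r\<ge>1. E r j \<le> K / (real r)\<^sup>2" if j: "j < N" for j
  proof -
    define s where "s = node N j"
    \<comment> \<open>Both s and pi - s are odd multiples of pi / (2 N), hence at least 2 d.\<close>
    define d where "d = pi / (4 * real N)"
    have d: "d > 0" using assms(6) by (simp add: d_def)
    have N: "pi = 4 * real N * d" using assms(6) by (simp add: d_def)
    have s: "s = 2 * (2 * real j + 1) * d" using assms(6) by (simp add: s_def node_def d_def field_simps)
    have "2 * (2 * real j + 1) * d \<le> (4 * real N - 2) * d"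
      using j d by (intro mult_right_mono) auto
    then have sd: "2 * d \<le> s" "s \<le> pi - 2 * d"
      using d N by (simp_all add: s algebra_simps)
    obtain C where C: "\<And>h M k R. \<lbrakk>h > 0; real M * h = s; 2 * real R * h = pi;
        d / 2 \<le> real k * h; real k * h \<le> d\<rbrakk> \<Longrightarrow>
      norm (\<Sum>n<2 * R. cell_error s (1 - \<alpha>) (end_weight \<alpha>) (reg_factor \<alpha> s G)
        (real n * h) ((real n + 1) * h)) \<le> C * h\<^sup>2"
      using sum_cell_error_bound[OF \<alpha> d sd C2] by blast
    \<comment> \<open>The step is 2 d / r, so 4 d^2 is its square times r^2.\<close>
    define K where "K = \<bar>prefactor L \<alpha> s\<bar> * (\<bar>C\<bar> * (4 * d\<^sup>2))"
    have K0: "K \<ge> 0" by (simp add: K_def)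
    (* For r = 1 we have r div 2 = 0, so no cell would count as close to s. *)
    have big: "E r j \<le> K / (real r)\<^sup>2" if r: "r \<ge> 2" for r
    proof -
      define h where "h = step N r"
      have h: "h = 2 * d / real r" "h > 0"
        using assms(6) r by (simp_all add: h_def step_def d_def)
      \<comment> \<open>The near window takes r div 2 cells on each side of \<open>s\<close>; as h =
        2 d / r, these inequalities place its half-width between d / 2 and \<open>d\<close>.\<close>
      have k: "2 * (r div 2) \<le> r" "r \<le> 4 * (r div 2)" using r by presburger+
      have "real r * (d / 2) \<le> real (4 * (r div 2)) * (d / 2)"
        using k(2) d by (intro mult_right_mono) auto
      then have k2: "d / 2 \<le> real (r div 2) * h" using r by (simp add: h field_simps)
      have "real (2 * (r div 2)) * d \<le> real r * d"
        using k(1) d by (intro mult_right_mono) auto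
      then have k1: "real (r div 2) * h \<le> d" using r by (simp add: h field_simps)
      have R: "2 * real (r * N) * h = pi" using r N by (simp add: h)
      have M: "real (r * (2 * j + 1)) * h = s"
        unfolding s_def h_def using r by (intro node_eq_grid[symmetric]) auto
      have "E r j = \<bar>prefactor L \<alpha> s\<bar> * norm (\<Sum>n<2 * (r * N). cell_error s (1 - \<alpha>) (end_weight \<alpha>)
          (reg_factor \<alpha> s G) (real n * h) ((real n + 1) * h))"
        unfolding E_def s_def h_def
        by (subst error_eq_sum_cell_error[OF \<alpha> assms(6) _ _ _ C2 G])
          (use r sd d s_def in auto)
      also have "\<dots> \<le> \<bar>prefactor L \<alpha> s\<bar> * (C * h\<^sup>2)"
        by (intro mult_left_mono C[OF h(2) M R k2 k1]) auto
      also have "\<dots> \<le> \<bar>prefactor L \<alpha> s\<bar> * (\<bar>C\<bar> * h\<^sup>2)"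
        by (intro mult_left_mono mult_right_mono) auto
      also have "\<dots> = K / (real r)\<^sup>2" by (simp add: h K_def power_divide power2_eq_square)
      finally show ?thesis .
    qed
    \<comment> \<open>The one coarse grid left over is absorbed by adding its own error to the
      constant.\<close>
    have "E r j \<le> (K + E 1 j) / (real r)\<^sup>2" if r: "r \<ge> 1" for r
    proof (cases "r = 1")
      case True
      then show ?thesis using K0 by simp
    next
      case False
      then have "E r j \<le> K / (real r)\<^sup>2" using r by (intro big) auto
      also have "\<dots> \<le> (K + E 1 j) / (real r)\<^sup>2"
        by (intro divide_right_mono) (auto simp: E_def)
      finally show ?thesis .
    qed
    then show ?thesis using K0 by (intro exI[of _ "K + E 1 j"]) (auto simp: E_def)
  qed
  then obtain K where K: "\<And>j. j < N \<Longrightarrow> K j \<ge> 0" "\<And>j r. j < N \<Longrightarrow> r \<ge> 1 \<Longrightarrow> E r j \<le> K j / (real r)\<^sup>2"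
    by metis
  \<comment> \<open>The constants so far depend on the node; there are N of them, and their sum
    serves for all. The 1 makes it strictly positive.\<close>
  have "E r j \<le> (1 + (\<Sum>j<N. K j)) / (real r)\<^sup>2" if "r \<ge> 1" "j < N" for r j
  proof -
    have "K j \<le> (\<Sum>j<N. K j)" using that K(1) by (intro member_le_sum) auto
    then have "K j / (real r)\<^sup>2 \<le> (1 + (\<Sum>j<N. K j)) / (real r)\<^sup>2"
      by (intro divide_right_mono) auto
    with K(2)[OF that(2,1)] show ?thesis by linarith
  qed
  moreover have "1 + (\<Sum>j<N. K j) > 0" using K(1) by (intro add_pos_nonneg sum_nonneg) auto
  ultimately show ?thesis unfolding E_def by blast
qed

end
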